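(* Let $p\ge 2n$ and let $f:(\mathbb{C}^n,0)\to(\mathbb{C}^p,0)$ be a map-germ for which $0$ is an isolated singularity, and suppose $f$ is $\mathcal{A}$-equivalent to $(g_k,h)$ for some $k\in\{1,\ldots,p-1\}$, where $g_k:(\mathbb{C}^n,0)\to(\mathbb{C}^k,0)$ and $h:(\mathbb{C}^n,0)\to(\mathbb{C}^{p-k},0)$. If $g_k$ is $\mathcal{A}$-finitely determined and $\delta_f$ is finite, then: (i) $\mathcal{A}_e\mathrm{cod}(f)\le \mathcal{A}_e\mathrm{cod}(g_k)+(p-k)\,\delta_f$. (ii) If $g_k$ is stable, then $\mathcal{A}_e\mathrm{cod}(f)=\mathrm{cod}\,T=(p-k)\,\delta_f-\dim_{\mathbb{C}}\operatorname{Ker}(\rho)$, where $T$ and $\rho$ are the subspace and the map associated with $(g_k,h)$ defined in the context.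
   Context: All germs are holomorphic; $\mathcal{O}_n$ is the ring of germs of functions at $0\in\mathbb{C}^n$. Two germs $f,g:(\mathbb{C}^n,0)\to(\mathbb{C}^p,0)$ are $\mathcal{A}$-equivalent if $g=\psi\circ f\circ\rho_0^{-1}$ for germs of biholomorphisms $\rho_0$ of $(\mathbb{C}^n,0)$ and $\psi$ of $(\mathbb{C}^p,0)$. A germ $f$ is $\mathcal{A}$-finitely determined if for some $r<\infty$ every germ with the same $r$-jet at $0$ is $\mathcal{A}$-equivalent to $f$. $\theta(f)\cong\mathcal{O}_n^p$ denotes the $\mathcal{O}_n$-module of vector fields along $f$, $\theta(n)\cong\mathcal{O}_n^n$ and $\theta(p)\cong\mathcal{O}_p^p$ the germs of vector fields on $(\mathbb{C}^n,0)$ and $(\mathbb{C}^p,0)$ (not required to vanish at $0$). Put $T\mathcal{A}_e(f)=\{df(\epsilon)+\eta\circ f:\ \epsilon\in\theta(n),\ \eta\in\theta(p)\}$ and $\mathcal{A}_e\mathrm{cod}(f)=\dim_{\mathbb{C}}\theta(f)/T\mathcal{A}_e(f)$; $f$ is stable if $T\mathcal{A}_e(f)=\theta(f)$. The same definitions apply to $g_k$ with target $\mathbb{C}^k$. The delta invariant is $\delta_f=\dim_{\mathbb{C}}\mathcal{O}_n/f^*(\mathcal{O}_p)$, where $f^*(\mathcal{O}_p)=\{u\circ f: u\in\mathcal{O}_p\}$. In coordinates where $f=(g_k,h)$, so that $\theta(f)\cong\theta(g_k)\oplus\theta(h)$, set $T=\{\omega_h\in\theta(h):\ (0,\omega_h)\in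 T\mathcal{A}_e(f)\}$ and $\mathrm{cod}\,T=\dim_{\mathbb{C}}\theta(h)/T$. Define $\overline{w}h:\theta(p)\to\theta(h)$ by $\overline{w}h(\eta)=(\eta_{k+1}\circ f,\ldots,\eta_p\circ f)$ for $\eta=(\eta_1,\ldots,\eta_p)$. One has $\overline{w}h(\theta(p))\subset T$, and $\rho:\theta(h)/\overline{w}h(\theta(p))\to\theta(h)/T$ is the natural projection, sending the class of $\omega_h$ to the class of $\omega_h$. "$0$ is an isolated singularity of $f$" means that $df$ is not injective at $0$ but is injective at all other points of some neighbourhood of $0$. *)

theory Defs
  imports "HOL-Analysis.Analysis"
begin

text \<open>
  Map-germs, diffeomorphism germs and vector fields are given by representatives: functions on the
  whole space of which only the behaviour near 0 matters.  The vector spaces whose dimensions are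
  taken consist of genuine germs.  Spaces \<open>\<complex>\<^sup>n\<close> are \<open>complex^'n\<close> with \<open>CARD('n) = n\<close>.
\<close>

section \<open>Germs at the origin\<close>

quotient_type (overloaded) ('a, 'b) germ = "'a::{topological_space, zero} \<Rightarrow> 'b"
  / "\<lambda>u v. \<forall>\<^sub>F x in nhds 0. u x = v x"
  morphisms rep_germ germ_of
proof (rule equivpI)
  show "reflp (\<lambda>u v :: 'a \<Rightarrow> 'b. \<forall>\<^sub>F x in nhds 0. u x = v x)"
    by (rule reflpI) simp
  show "symp (\<lambda>u v :: 'a \<Rightarrow> 'b. \<forall>\<^sub>F x in nhds 0. u x = v x)"
    by (rule sympI, erule eventually_mono) simp
  show "transp (\<lambda>u v :: 'a \<Rightarrow> 'b. \<forall>\<^sub>F x in nhds 0. u x = v x)"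
    by (rule transpI, erule (1) eventually_elim2) simp
qed

instantiation germ :: ("{topological_space, zero}", ab_group_add) ab_group_add
begin

lift_definition zero_germ :: "('a, 'b) germ" is "\<lambda>x. 0" .

lift_definition plus_germ :: "('a, 'b) germ \<Rightarrow> ('a, 'b) germ \<Rightarrow> ('a, 'b) germ"
  is "\<lambda>u v x. u x + v x"
  by (auto elim: eventually_elim2)

lift_definition minus_germ :: "('a, 'b) germ \<Rightarrow> ('a, 'b) germ \<Rightarrow> ('a, 'b) germ"
  is "\<lambda>u v x. u x - v x"
  by (auto elim: eventually_elim2)

lift_definition uminus_germ :: "('a, 'b) germ \<Rightarrow> ('a, 'b) germ"
  is "\<lambda>u x. - u x"
  by (auto elim: eventually_mono)

instance
proof
  fix a b c :: "('a, 'b) germ"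
  show "a + b + c = a + (b + c)" by transfer (simp add: add.assoc)
  show "a + b = b + a" by transfer (simp add: add.commute)
  show "0 + a = a" by transfer simp
  show "- a + a = 0" by transfer simp
  show "a - b = a + - b" by transfer simp
qed

end

text \<open>Pointwise scalar multiplication of germs, for a given scalar multiplication of the values
  (\<open>(*)\<close> for values in \<open>complex\<close>, \<open>(*s)\<close> for values in \<open>complex^'p\<close>).\<close>

lift_definition germ_scale ::
    "('c \<Rightarrow> 'b \<Rightarrow> 'b) \<Rightarrow> 'c \<Rightarrow> ('a::{topological_space, zero}, 'b) germ \<Rightarrow> ('a, 'b) germ"
  is "\<lambda>s c u x. s c (u x)"
  by (auto elim: eventually_mono)

lemma vector_space_germ_scale:
  fixes s :: "'a::field \<Rightarrow> 'b::ab_group_add \<Rightarrow> 'b"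
  assumes "vector_space s"
  shows "vector_space
    (germ_scale s :: 'a \<Rightarrow> ('c::{topological_space, zero}, 'b) germ \<Rightarrow> ('c, 'b) germ)"
proof -
  interpret vector_space s by fact
  have rep: "\<exists>u. x = germ_of u" for x :: "('c, 'b) germ"
    by (induct x rule: germ.abs_induct) blast
  show ?thesis
  proof
    fix a b :: 'a and x y :: "('c, 'b) germ"
    obtain u v where [simp]: "x = germ_of u" "y = germ_of v"
      using rep by blast
    show "germ_scale s a (x + y) = germ_scale s a x + germ_scale s a y"
      by (simp add: germ_scale.abs_eq plus_germ.abs_eq scale_right_distrib)
    show "germ_scale s (a + b) x = germ_scale s a x + germ_scale s b x"
      by (simp add: germ_scale.abs_eq plus_germ.abs_eq scale_left_distrib)
    show "germ_scale s a (germ_scale s b x) = germ_scale s (a * b) x"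
      by (simp add: germ_scale.abs_eq)
    show "germ_scale s 1 x = x"
      by (simp add: germ_scale.abs_eq)
  qed
qed


section \<open>Quotient spaces and their dimension\<close>

definition coset :: "'v::ab_group_add set \<Rightarrow> 'v \<Rightarrow> 'v set" where
  "coset W v = {u. u - v \<in> W}"

definition quotient_space :: "'v::ab_group_add set \<Rightarrow> 'v set \<Rightarrow> 'v set set" where
  "quotient_space V W = coset W ` V"

text \<open>The classes modulo \<open>W\<close> of the elements of \<open>S\<close> are pairwise distinct and linearly
  independent.\<close>

definition independent_mod ::
    "('c::field \<Rightarrow> 'v \<Rightarrow> 'v) \<Rightarrow> 'v::ab_group_add set \<Rightarrow> 'v set \<Rightarrow> bool" where
  "independent_mod s W S \<longleftrightarrow>
     (\<forall>a. (\<Sum>v\<in>S. s (a v) v) \<in> W \<longrightarrow> (\<forall>v\<in>S. a v = 0))"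

text \<open>The dimension of a subspace \<open>K\<close>, a set of cosets of \<open>W\<close>, of a quotient space by \<open>W\<close>.
  A set of classes is represented by a set \<open>S\<close> of elements of these classes.\<close>

definition class_dim ::
    "('c::field \<Rightarrow> 'v \<Rightarrow> 'v) \<Rightarrow> 'v::ab_group_add set \<Rightarrow> 'v set set \<Rightarrow> enat" where
  "class_dim s W K =
     (SUP S\<in>{S. finite S \<and> S \<subseteq> \<Union>K \<and> independent_mod s W S}. enat (card S))"

definition quotient_dim ::
    "('c::field \<Rightarrow> 'v \<Rightarrow> 'v) \<Rightarrow> 'v::ab_group_add set \<Rightarrow> 'v set \<Rightarrow> enat" where
  "quotient_dim s V W = class_dim s W (quotient_space V W)"

text \<open>For \<open>W \<subseteq> T\<close>, the natural projection from the quotient by \<open>W\<close> to the quotient by \<open>T\<close>: on a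
  coset \<open>C\<close> of \<open>W\<close> all the sets \<open>coset T v\<close> with \<open>v \<in> C\<close> coincide.\<close>

definition natural_projection :: "'v::ab_group_add set \<Rightarrow> 'v set \<Rightarrow> 'v set" where
  "natural_projection T C = (\<Union>v\<in>C. coset T v)"


section \<open>Holomorphic germs\<close>

definition holomorphic_at_0 :: "(complex^'n \<Rightarrow> complex) \<Rightarrow> bool" where
  "holomorphic_at_0 u \<longleftrightarrow>
     (\<forall>\<^sub>F z in nhds 0. \<exists>D. (u has_derivative D) (at z) \<and> Vector_Spaces.linear (*s) (*) D)"

definition holomorphic_map_at_0 :: "(complex^'n \<Rightarrow> complex^'p) \<Rightarrow> bool" where
  "holomorphic_map_at_0 f \<longleftrightarrow> (\<forall>j. holomorphic_at_0 (\<lambda>z. f z $ j))"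

definition map_germ :: "(complex^'n \<Rightarrow> complex^'p) \<Rightarrow> bool" where
  "map_germ f \<longleftrightarrow> holomorphic_map_at_0 f \<and> f 0 = 0"

text \<open>\<open>\<O>\<^sub>n\<close>, and \<open>\<theta>(f)\<close> for \<open>f\<close> from \<open>\<complex>\<^sup>n\<close> to \<open>\<complex>\<^sup>p\<close>; as a space of germs \<open>\<theta>(f)\<close> depends only on \<open>n\<close>
  and \<open>p\<close>.\<close>

definition function_germs :: "(complex^'n, complex) germ set" where
  "function_germs = {germ_of u | u. holomorphic_at_0 u}"

definition theta :: "(complex^'n, complex^'p) germ set" where
  "theta = {germ_of v | v. holomorphic_map_at_0 v}"

abbreviation differential ::
    "(complex^'n \<Rightarrow> complex^'p) \<Rightarrow> complex^'n \<Rightarrow> complex^'n \<Rightarrow> complex^'p" where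
  "differential f z \<equiv> frechet_derivative f (at z)"

definition isolated_singularity :: "(complex^'n \<Rightarrow> complex^'p) \<Rightarrow> bool" where
  "isolated_singularity f \<longleftrightarrow>
     \<not> inj (differential f 0) \<and> (\<forall>\<^sub>F z in at 0. inj (differential f z))"


section \<open>\<open>\<A>\<close>-equivalence and finite determinacy\<close>

definition inverse_biholomorphisms :: "(complex^'n \<Rightarrow> complex^'n) \<Rightarrow> (complex^'n \<Rightarrow> complex^'n) \<Rightarrow> bool" where
  "inverse_biholomorphisms \<phi> \<phi>' \<longleftrightarrow>
     map_germ \<phi> \<and> map_germ \<phi>' \<and>
     (\<forall>\<^sub>F z in nhds 0. \<phi>' (\<phi> z) = z) \<and> (\<forall>\<^sub>F z in nhds 0. \<phi> (\<phi>' z) = z)"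

definition A_equivalent ::
    "(complex^'n \<Rightarrow> complex^'p) \<Rightarrow> (complex^'n \<Rightarrow> complex^'p) \<Rightarrow> bool" where
  "A_equivalent f g \<longleftrightarrow>
     (\<exists>\<rho>\<^sub>0 \<rho>\<^sub>0' \<psi> \<psi>'. inverse_biholomorphisms \<rho>\<^sub>0 \<rho>\<^sub>0' \<and> inverse_biholomorphisms \<psi> \<psi>' \<and>
        (\<forall>\<^sub>F z in nhds 0. g z = \<psi> (f (\<rho>\<^sub>0' z))))"

definition partial_deriv :: "'n \<Rightarrow> (complex^'n \<Rightarrow> complex) \<Rightarrow> complex^'n \<Rightarrow> complex" where
  "partial_deriv i u z = deriv (\<lambda>t. u (z + axis i t)) 0"

text \<open>Equality of all partial derivatives at 0 of order at most \<open>r\<close>, that is of the Taylor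
  polynomials of degree \<open>r\<close>.\<close>

definition same_jet :: "nat \<Rightarrow> (complex^'n \<Rightarrow> complex^'p) \<Rightarrow> (complex^'n \<Rightarrow> complex^'p) \<Rightarrow> bool" where
  "same_jet r f g \<longleftrightarrow>
     (\<forall>is j. length is \<le> r \<longrightarrow>
        foldr partial_deriv is (\<lambda>z. f z $ j) 0 = foldr partial_deriv is (\<lambda>z. g z $ j) 0)"

definition A_finitely_determined :: "(complex^'n \<Rightarrow> complex^'p) \<Rightarrow> bool" where
  "A_finitely_determined f \<longleftrightarrow>
     (\<exists>r. \<forall>g. map_germ g \<and> same_jet r f g \<longrightarrow> A_equivalent f g)"


section \<open>Codimension, stability, delta invariant\<close>

definition TAe :: "(complex^'n \<Rightarrow> complex^'p) \<Rightarrow> (complex^'n, complex^'p) germ set" where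
  "TAe f = {germ_of (\<lambda>z. differential f z (\<epsilon> z) + \<eta> (f z)) | \<epsilon> \<eta>.
     holomorphic_map_at_0 \<epsilon> \<and> holomorphic_map_at_0 \<eta>}"

definition Ae_cod :: "(complex^'n \<Rightarrow> complex^'p) \<Rightarrow> enat" where
  "Ae_cod f = quotient_dim (germ_scale (*s)) theta (TAe f)"

definition stable_germ :: "(complex^'n \<Rightarrow> complex^'p) \<Rightarrow> bool" where
  "stable_germ f \<longleftrightarrow> TAe f = theta"

definition pullback_germs :: "(complex^'n \<Rightarrow> complex^'p) \<Rightarrow> (complex^'n, complex) germ set" where
  "pullback_germs f = {germ_of (\<lambda>z. u (f z)) | u. holomorphic_at_0 u}"

definition delta :: "(complex^'n \<Rightarrow> complex^'p) \<Rightarrow> enat" where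
  "delta f = quotient_dim (germ_scale (*)) function_germs (pullback_germs f)"


section \<open>Germs of the form \<open>(g, h)\<close>\<close>

text \<open>\<open>\<complex>\<^sup>k \<times> \<complex>\<^sup>m\<close> is identified with \<open>complex^('k + 'm)\<close>, the first block of coordinates being indexed by
  \<open>Inl\<close> and the second by \<open>Inr\<close>.\<close>

definition join :: "complex^'k \<Rightarrow> complex^'m \<Rightarrow> complex^('k::finite + 'm::finite)" where
  "join v w = (\<chi> i. case i of Inl a \<Rightarrow> v $ a | Inr b \<Rightarrow> w $ b)"

definition second_block :: "complex^('k::finite + 'm::finite) \<Rightarrow> complex^'m" where
  "second_block v = (\<chi> b. v $ Inr b)"

definition pair_map ::
    "(complex^'n \<Rightarrow> complex^'k) \<Rightarrow> (complex^'n \<Rightarrow> complex^'m) \<Rightarrow> complex^'n \<Rightarrow> complex^('k::finite + 'm::finite)" where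
  "pair_map g h z = join (g z) (h z)"

definition T_space ::
    "(complex^'n \<Rightarrow> complex^'k) \<Rightarrow> (complex^'n \<Rightarrow> complex^'m) \<Rightarrow> (complex^'n, complex^'m) germ set" where
  "T_space g h = {germ_of \<omega> | \<omega>. holomorphic_map_at_0 \<omega> \<and>
     germ_of (\<lambda>z. join 0 (\<omega> z)) \<in> TAe (pair_map g h)}"

definition cod_T :: "(complex^'n \<Rightarrow> complex^'k) \<Rightarrow> (complex^'n \<Rightarrow> complex^'m) \<Rightarrow> enat" where
  "cod_T g h = quotient_dim (germ_scale (*s)) theta (T_space g h)"

definition wh_bar ::
    "(complex^'n \<Rightarrow> complex^'k) \<Rightarrow> (complex^'n \<Rightarrow> complex^'m)
      \<Rightarrow> (complex^('k::finite + 'm::finite) \<Rightarrow> complex^('k::finite + 'm::finite)) \<Rightarrow> (complex^'n, complex^'m) germ" where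
  "wh_bar g h \<eta> = germ_of (\<lambda>z. second_block (\<eta> (pair_map g h z)))"

definition wh_image ::
    "(complex^'n \<Rightarrow> complex^'k) \<Rightarrow> (complex^'n \<Rightarrow> complex^'m) \<Rightarrow> (complex^'n, complex^'m) germ set" where
  "wh_image g h = wh_bar g h ` {\<eta>. holomorphic_map_at_0 \<eta>}"

text \<open>The zero element of \<open>\<theta>(h)/T\<close> is the coset of 0.\<close>

definition Ker_rho ::
    "(complex^'n \<Rightarrow> complex^'k) \<Rightarrow> (complex^'n \<Rightarrow> complex^'m) \<Rightarrow> (complex^'n, complex^'m) germ set set" where
  "Ker_rho g h = {C \<in> quotient_space theta (wh_image g h).
     natural_projection (T_space g h) C = coset (T_space g h) 0}"

definition dim_Ker_rho :: "(complex^'n \<Rightarrow> complex^'k) \<Rightarrow> (complex^'n \<Rightarrow> complex^'m) \<Rightarrow> enat" where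
  "dim_Ker_rho g h = class_dim (germ_scale (*s)) (wh_image g h) (Ker_rho g h)"

end

(*
  All the invariants involved are invariant under A-equivalence, so one may take f = (g, h).  Projecting
  theta(f) to theta(g), with kernel theta(h), splits the codimension as
    Ae_cod f = dim theta(g) / pi(T Ae f) + cod T,
  and T Ae g is contained in pi(T Ae f), so the first term is at most Ae_cod g and vanishes when g is
  stable.  On the other hand the image of wh is the set of all vector fields along h with components
  in f^*(O_p), which has codimension (p - k) delta_f and lies in T; hence
    cod T + dim Ker rho = (p - k) delta_f.
  The analytic input is that the differential of a holomorphic germ depends holomorphically on the
  point: by the Cauchy formula on a small circle the directional derivative of u is an integral of
  values of u, which makes it first continuous, then differentiable under the integral sign.
*)

theory Submission
  imports Defs "HOL-Complex_Analysis.Cauchy_Integral_Formula"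
begin

section \<open>Directional derivatives of holomorphic functions\<close>

text \<open>Holomorphy is assumed only as the existence of a complex linear derivative near 0, yet
  the elements of \<open>TAe f\<close>, and the transports between tangent spaces of equivalent
  germs, contain differentials evaluated at moving points. That these are again elements of
  \<open>theta\<close> is what the Cauchy formula has to supply. The other obstacle is that the
  dimensions involved may be infinite and that quotients are mere sets of cosets. All counting is
  therefore done with finite sets of representatives independent modulo a subspace, and every
  dimension formula is a sum in \<open>enat\<close>. A difference is formed only at the end, where a
  finite delta invariant makes both terms of the sum finite. Part (i) is an inequality for two
  reasons: the first block of a target field of (g, h) may depend on the coordinates of h, so the
  projected tangent space can exceed \<open>TAe g\<close>; and T can exceed the image of
  \<open>wh_bar\<close>. Stability of g removes the first loss, and dim Ker rho measures the
  second.\<close>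

lemma complex_linear_iff:
  fixes D :: "complex^'n \<Rightarrow> complex"
  shows "Vector_Spaces.linear (*s) (*) D \<longleftrightarrow>
    (\<forall>x y. D (x + y) = D x + D y) \<and> (\<forall>c x. D (c *s x) = c * D x)"
  unfolding Vector_Spaces.linear_iff
  using vec.vector_space_axioms vector_space_over_itself.vector_space_axioms by blast

lemma norm_vector_scalar_mult:
  fixes x :: "complex^'n"
  shows "norm (c *s x) = norm c * norm x"
  by (simp add: norm_vec_def norm_mult L2_set_right_distrib)

lemma bounded_linear_vector_scalar_mult:
  fixes e :: "complex^'n"
  shows "bounded_linear (\<lambda>t. t *s e)"
proof (rule bounded_linear_intro[where K = "norm e"])
  show "norm (t *s e) \<le> norm t * norm e" for t
    by (simp add: norm_vector_scalar_mult)
qed (simp_all add: vec_eq_iff algebra_simps)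

text \<open>On the complex line z + t e the function u becomes a function of one variable whose
  derivative at 0 is \<open>D z e\<close>, and Cauchy's formula expresses it through values on a
  circle. One circle serves all z in a ball, so z enters the integrand only through the argument of
  u; this is what allows differentiation in z.\<close>

lemma directional_derivative_Cauchy:
  fixes u :: "complex^'n \<Rightarrow> complex"
  assumes S: "open S"
    and D: "\<And>z. z \<in> S \<Longrightarrow> (u has_derivative D z) (at z)"
    and lin: "\<And>z. z \<in> S \<Longrightarrow> Vector_Spaces.linear (*s) (*) (D z)"
    and z0: "z0 \<in> S"
  obtains r c where "r > 0" "continuous_on {0..1} c" "\<And>s. s \<in> {0..1::real} \<Longrightarrow> c s \<noteq> (0::complex)"
    "\<And>z s. z \<in> ball z0 r \<Longrightarrow> s \<in> {0..1} \<Longrightarrow> z + c s *s e \<in> S"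
    "\<And>z. z \<in> ball z0 r \<Longrightarrow> D z e = integral {0..1} (\<lambda>s. u (z + c s *s e) / c s)"
proof -
  obtain R where R: "R > 0" "ball z0 R \<subseteq> S"
    using S z0 open_contains_ball by blast
  \<comment> \<open>Half of the radius R is left for z and half for the displacement t e. The
    summand 1 in the next denominator covers e = 0 and makes the bound on the displacement
    strict.\<close>
  define r where "r = R / 2"
  define d where "d = r / (norm e + 1)"
  have "r > 0" using R by (simp add: r_def)
  have "norm e + 1 > 0" by (simp add: add_nonneg_pos)
  then have d: "d > 0" "d * norm e < r"
    using \<open>r > 0\<close> by (auto simp: d_def field_simps)
  have inS: "z + t *s e \<in> S" if "z \<in> ball z0 r" "t \<in> cball 0 d" for z t
  proof -
    have "norm (t *s e) \<le> d * norm e"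
      using that by (simp add: norm_vector_scalar_mult mult_right_mono)
    then have "dist z0 (z + t *s e) < r + r"
      using that d dist_triangle_lt[of z0 z "z + t *s e" "r + r"]
      by (auto simp: dist_norm)
    then show ?thesis using R by (auto simp: r_def)
  qed
  define c where "c = circlepath 0 d"
  have norm_c: "norm (c s) = d" for s
    using d by (simp add: c_def circlepath norm_mult)
  have c_nz: "c s \<noteq> 0" for s
    using norm_c[of s] d by auto
  have "D z e = integral {0..1} (\<lambda>s. u (z + c s *s e) / c s)" if z: "z \<in> ball z0 r" for z
  proof -
    define p where "p = (\<lambda>t. u (z + t *s e))"
    have der: "(p has_field_derivative D (z + t *s e) e) (at t)" if t: "t \<in> cball 0 d" for t
    proof -
      have "((\<lambda>t. z + t *s e) has_derivative (\<lambda>t. t *s e)) (at t)"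
        using has_derivative_add[OF has_derivative_const bounded_linear_imp_has_derivative
            [OF bounded_linear_vector_scalar_mult]] by simp
      from has_derivative_compose[OF this, of u "D (z + t *s e)"] D[OF inS[OF z t]]
      have "(p has_derivative (\<lambda>h. D (z + t *s e) (h *s e))) (at t)"
        by (simp add: p_def)
      then show ?thesis
        using lin[OF inS[OF z t]]
        by (simp add: has_field_derivative_def complex_linear_iff mult.commute[of _ "D _ _"])
    qed
    have "p holomorphic_on cball 0 d"
      unfolding holomorphic_on_def
      using der field_differentiable_def field_differentiable_at_within by blast
    then have "(p has_field_derivative (1 / (2 * of_real pi * \<i>) *
        contour_integral (circlepath 0 d) (\<lambda>t. p t / (t - 0)^2))) (at 0)"
      using d by (intro Cauchy_derivative_integral_circlepath)
        (auto intro: holomorphic_on_imp_continuous_on holomorphic_on_subset)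
    moreover have "(p has_field_derivative D z e) (at 0)"
      using der[of 0] d by simp
    ultimately have "D z e = 1 / (2 * of_real pi * \<i>) * contour_integral c (\<lambda>t. p t / t^2)"
      using DERIV_unique by (auto simp: c_def)
    \<comment> \<open>On a circle centred at 0 the velocity is 2 pi i c, which cancels one factor of
      c^2 and, later, the prefactor of Cauchy's formula.\<close>
    also have "contour_integral c (\<lambda>t. p t / t^2)
        = integral {0..1} (\<lambda>s. 2 * of_real pi * \<i> * (p (c s) / c s))"
      unfolding contour_integral_integral
    proof (rule Henstock_Kurzweil_Integration.integral_cong)
      fix s :: real assume "s \<in> {0..1}"
      have "vector_derivative c (at s) = 2 * of_real pi * \<i> * c s"
        by (simp add: c_def vector_derivative_circlepath) (simp add: circlepath)
      then show "p (c s) / (c s)^2 * vector_derivative c (at s)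
          = 2 * of_real pi * \<i> * (p (c s) / c s)"
        using c_nz[of s] by (simp add: power2_eq_square field_simps)
    qed
    also have "\<dots> = 2 * of_real pi * \<i> * integral {0..1} (\<lambda>s. p (c s) / c s)"
      by (rule Henstock_Kurzweil_Integration.integral_mult_right)
    finally show ?thesis by (simp add: p_def)
  qed
  moreover have "continuous_on {0..1} c"
    by (simp add: c_def circlepath continuous_intros)
  ultimately show ?thesis
    using \<open>r > 0\<close> c_nz inS norm_c by (intro that[of r c]) auto
qed

text \<open>Joint continuity is the hypothesis of the theorems on integrals with a parameter. It is
  needed for u itself and again with a directional derivative of u in place of u.\<close>

lemma continuous_on_param_sub_cball:
  fixes u :: "complex^'n \<Rightarrow> complex"
  assumes "continuous_on S u" "continuous_on {0..1} c"
    and "\<And>z s. z \<in> U \<Longrightarrow> s \<in> {0..1} \<Longrightarrow> z + c s *s e \<in> S"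
    and "\<And>s. s \<in> {0..1::real} \<Longrightarrow> c s \<noteq> 0"
  shows "continuous_on (U \<times> {0..1}) (\<lambda>(z, s). u (z + c s *s e) / c s)"
proof -
  have c: "continuous_on (U \<times> {0..1}) (\<lambda>x. c (snd x))"
    by (rule continuous_on_compose2[OF assms(2)]) (auto intro: continuous_intros)
  have "continuous_on (U \<times> {0..1}) (\<lambda>x. c (snd x) *s e)"
    by (rule continuous_on_compose2[OF linear_continuous_on[OF bounded_linear_vector_scalar_mult] c])
      auto
  then have "continuous_on (U \<times> {0..1}) (\<lambda>x. u (fst x + c (snd x) *s e))"
    by (intro continuous_on_compose2[OF assms(1)]) (auto intro!: continuous_intros assms(3))
  then show ?thesis
    unfolding split_beta using c assms(4) by (auto intro!: continuous_intros)
qed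

text \<open>The Cauchy integral has a jointly continuous integrand. This has to come before
  differentiability, because the Leibniz rule asks for a continuous derivative of the integrand, and
  that derivative consists of values of D.\<close>

lemma directional_derivative_continuous:
  fixes u :: "complex^'n \<Rightarrow> complex"
  assumes S: "open S"
    and D: "\<And>z. z \<in> S \<Longrightarrow> (u has_derivative D z) (at z)"
    and lin: "\<And>z. z \<in> S \<Longrightarrow> Vector_Spaces.linear (*s) (*) (D z)"
  shows "continuous_on S (\<lambda>z. D z e)"
proof -
  have u: "continuous_on S u"
    using D by (meson continuous_at_imp_continuous_on has_derivative_continuous)
  have "isCont (\<lambda>z. D z e) z0" if z0: "z0 \<in> S" for z0
  proof -
    obtain r c where rc: "r > 0" "continuous_on {0..1} c" "\<And>s. s \<in> {0..1::real} \<Longrightarrow> c s \<noteq> (0::complex)"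
      "\<And>z s. z \<in> ball z0 r \<Longrightarrow> s \<in> {0..1} \<Longrightarrow> z + c s *s e \<in> S"
      "\<And>z. z \<in> ball z0 r \<Longrightarrow> D z e = integral {0..1} (\<lambda>s. u (z + c s *s e) / c s)"
      by (rule directional_derivative_Cauchy[OF S D lin z0, of e]; (assumption | (rule that; assumption)))
    have "continuous_on (ball z0 r) (\<lambda>z. integral (cbox 0 1) (\<lambda>s. u (z + c s *s e) / c s))"
      by (rule integral_continuous_on_param, unfold cbox_interval)
        (rule continuous_on_param_sub_cball[OF u rc(2,4,3)])
    then have "continuous_on (ball z0 r) (\<lambda>z. D z e)"
      unfolding cbox_interval
      by (rule continuous_on_eq) (simp only: rc(5))
    then show ?thesis
      using rc(1) by (simp add: continuous_on_eq_continuous_at)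
  qed
  then show ?thesis by (simp add: continuous_at_imp_continuous_on)
qed

lemma continuous_on_Pair_const: "continuous_on X (Pair z)"
  by (intro continuous_on_Pair[where f = "\<lambda>_. z" and g = "\<lambda>x. x", simplified])

lemma directional_derivative_holomorphic:
  fixes u :: "complex^'n \<Rightarrow> complex"
  assumes S: "open S"
    and D: "\<And>z. z \<in> S \<Longrightarrow> (u has_derivative D z) (at z)"
    and lin: "\<And>z. z \<in> S \<Longrightarrow> Vector_Spaces.linear (*s) (*) (D z)"
    and z0: "z0 \<in> S"
  shows "\<exists>E. ((\<lambda>z. D z e) has_derivative E) (at z0) \<and> Vector_Spaces.linear (*s) (*) E"
proof -
  have u: "continuous_on S u"
    using D by (meson continuous_at_imp_continuous_on has_derivative_continuous)
  obtain r c where rc: "r > 0" "continuous_on {0..1} c" "\<And>s. s \<in> {0..1::real} \<Longrightarrow> c s \<noteq> (0::complex)"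
    "\<And>z s. z \<in> ball z0 r \<Longrightarrow> s \<in> {0..1} \<Longrightarrow> z + c s *s e \<in> S"
    "\<And>z. z \<in> ball z0 r \<Longrightarrow> D z e = integral {0..1} (\<lambda>s. u (z + c s *s e) / c s)"
    by (rule directional_derivative_Cauchy[OF S D lin z0, of e]; (assumption | (rule that; assumption)))
  \<comment> \<open>The derivative of the integrand in z, packaged as a bounded linear map because
    the Leibniz rule integrates operator-valued functions.\<close>
  define B where "B = (\<lambda>z s. Blinfun (\<lambda>v. D (z + c s *s e) v / c s))"
  have B: "blinfun_apply (B z s) = (\<lambda>v. D (z + c s *s e) v / c s)"
    if "z \<in> ball z0 r" "s \<in> {0..1}" for z s
    unfolding B_def
    by (rule bounded_linear_Blinfun_apply)
      (rule bounded_linear_compose[OF bounded_linear_divide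
        has_derivative_bounded_linear[OF D[OF rc(4)[OF that]]]])
  have fx: "((\<lambda>z. u (z + c s *s e) / c s) has_derivative blinfun_apply (B z s)) (at z within ball z0 r)"
    if "z \<in> ball z0 r" "s \<in> cbox 0 1" for z s
  proof -
    have s: "s \<in> {0..1}" using that by simp
    have "((\<lambda>z. z + c s *s e) has_derivative (\<lambda>v. v)) (at z)"
      by (auto intro!: derivative_eq_intros)
    from has_derivative_compose[OF this D[OF rc(4)[OF that(1) s]]]
    have "((\<lambda>z. u (z + c s *s e)) has_derivative D (z + c s *s e)) (at z)" .
    then have "((\<lambda>z. u (z + c s *s e) / c s) has_derivative (\<lambda>v. D (z + c s *s e) v / c s)) (at z)"
      by (rule bounded_linear.has_derivative[OF bounded_linear_divide])
    then show ?thesis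
      unfolding B[OF that(1) s] by (rule has_derivative_at_withinI)
  qed
  \<comment> \<open>On a finite-dimensional domain, continuity in the operator norm follows from
    continuity at each fixed vector, which is continuity of a directional derivative.\<close>
  have cont_B: "continuous_on (ball z0 r \<times> cbox 0 1) (\<lambda>(z, s). B z s)"
  proof (rule continuous_on_blinfun_componentwise)
    fix i :: "complex^'n"
    have "continuous_on (ball z0 r \<times> {0..1}) (\<lambda>(z, s). D (z + c s *s e) i / c s)"
      using continuous_on_param_sub_cball[OF directional_derivative_continuous[OF S D lin] rc(2,4,3)] .
    then show "continuous_on (ball z0 r \<times> cbox 0 1) (\<lambda>x. blinfun_apply (case x of (z, s) \<Rightarrow> B z s) i)"
      by (rule continuous_on_cong[THEN iffD1, rotated -1]) (auto simp: B)
  qed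
  have "(\<lambda>s. u (z + c s *s e) / c s) integrable_on cbox 0 1" if "z \<in> ball z0 r" for z
  proof (rule integrable_continuous)
    have "continuous_on (ball z0 r \<times> {0..1}) (\<lambda>(z, s). u (z + c s *s e) / c s)"
      by (rule continuous_on_param_sub_cball[OF u rc(2,4,3)])
    from continuous_on_compose2[OF this continuous_on_Pair_const, of z "cbox 0 1"] that
    show "continuous_on (cbox 0 1) (\<lambda>s. u (z + c s *s e) / c s)"
      by (simp add: image_subset_iff)
  qed
  from leibniz_rule[OF fx this cont_B]
  have "((\<lambda>z. integral (cbox 0 1) (\<lambda>s. u (z + c s *s e) / c s)) has_derivative
      integral (cbox 0 1) (B z0)) (at z0 within ball z0 r)"
    using rc(1) by simp
  then have "((\<lambda>z. integral (cbox 0 1) (\<lambda>s. u (z + c s *s e) / c s)) has_derivative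
      integral (cbox 0 1) (B z0)) (at z0)"
    using rc(1) at_within_open[of z0 "ball z0 r"] by simp
  then have *: "((\<lambda>z. D z e) has_derivative integral (cbox 0 1) (B z0)) (at z0)"
    by (rule has_derivative_transform_within_open[of _ _ _ _ "ball z0 r"])
      (use rc(1,5) in auto)
  have "continuous_on (cbox 0 1) (B z0)"
    using continuous_on_compose2[OF cont_B continuous_on_Pair_const, of z0 "cbox 0 1"] rc(1)
    by (simp add: image_subset_iff)
  then have B_int: "B z0 integrable_on cbox 0 1"
    by (rule integrable_continuous)
  \<comment> \<open>Evaluation at v is bounded linear and so commutes with the integral. Additivity
    of the derivative comes for free; complex homogeneity is inherited from D under the
    integral.\<close>
  have app: "blinfun_apply (integral (cbox 0 1) (B z0)) v
      = integral (cbox 0 1) (\<lambda>s. D (z0 + c s *s e) v / c s)" for v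
  proof -
    have "integral (cbox 0 1) ((\<lambda>X. blinfun_apply X v) \<circ> B z0)
        = blinfun_apply (integral (cbox 0 1) (B z0)) v"
      by (rule integral_linear[OF B_int blinfun.bounded_linear_left])
    then have "blinfun_apply (integral (cbox 0 1) (B z0)) v
        = integral (cbox 0 1) ((\<lambda>X. blinfun_apply X v) \<circ> B z0)" by simp
    also have "\<dots> = integral (cbox 0 1) (\<lambda>s. D (z0 + c s *s e) v / c s)"
      by (rule Henstock_Kurzweil_Integration.integral_cong) (use rc(1) in \<open>simp add: B\<close>)
    finally show ?thesis .
  qed
  have "Vector_Spaces.linear (*s) (*) (blinfun_apply (integral (cbox 0 1) (B z0)))"
  unfolding complex_linear_iff
  proof (intro conjI allI)
    fix a v
    have "blinfun_apply (integral (cbox 0 1) (B z0)) (a *s v)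
        = integral (cbox 0 1) (\<lambda>s. a * (D (z0 + c s *s e) v / c s))"
      unfolding app
    proof (rule Henstock_Kurzweil_Integration.integral_cong)
      fix s :: real assume "s \<in> cbox 0 1"
      then have "z0 + c s *s e \<in> S" using rc(1,4) by simp
      from lin[OF this]
      show "D (z0 + c s *s e) (a *s v) / c s = a * (D (z0 + c s *s e) v / c s)"
        by (simp add: complex_linear_iff)
    qed
    also have "\<dots> = a * blinfun_apply (integral (cbox 0 1) (B z0)) v"
      unfolding app by (rule Henstock_Kurzweil_Integration.integral_mult_right)
    finally show "blinfun_apply (integral (cbox 0 1) (B z0)) (a *s v)
        = a * blinfun_apply (integral (cbox 0 1) (B z0)) v" .
  qed (simp add: blinfun.add_right)
  then show ?thesis using * by blast
qed


section \<open>Dimensions of quotients\<close>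

text \<open>Testing finite lower bounds suffices: if one summand is infinite, its lower bounds are
  arbitrarily large and force q to be infinite. Sums of suprema can thus be bounded by looking at
  finite independent sets only.\<close>

lemma enat_add_leI:
  fixes a b q :: enat
  assumes "\<And>m n. enat m \<le> a \<Longrightarrow> enat n \<le> b \<Longrightarrow> enat (m + n) \<le> q"
  shows "a + b \<le> q"
proof -
  have unbounded: "q = \<infinity>" if "\<And>n. enat n \<le> q"
  proof (cases q)
    case (enat m)
    then show ?thesis using that[of "Suc m"] by simp
  qed
  consider m n where "a = enat m" "b = enat n" | "a = \<infinity>" | "b = \<infinity>"
    by (cases a; cases b) auto
  then show ?thesis
  proof cases
    case 1
    then show ?thesis using assms[of m n] by simp
  next
    case 2
    then have "enat m \<le> q" for m using assms[of m 0] by (simp flip: zero_enat_def)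
    then show ?thesis using unbounded by simp
  next
    case 3
    then have "enat n \<le> q" for n using assms[of 0 n] by (simp flip: zero_enat_def)
    then show ?thesis using unbounded by simp
  qed
qed

text \<open>The dimension of the image of V modulo W, counted by representatives in V. W need not be
  contained in V, which is used when V is a copy of \<open>theta\<close> inside a larger space of
  vector fields.\<close>

definition qdim :: "('c::field \<Rightarrow> 'v \<Rightarrow> 'v) \<Rightarrow> 'v::ab_group_add set \<Rightarrow> 'v set \<Rightarrow> enat" where
  "qdim s V W = (SUP S\<in>{S. finite S \<and> S \<subseteq> V \<and> independent_mod s W S}. enat (card S))"

lemma qdim_leI:
  assumes "\<And>S. finite S \<Longrightarrow> S \<subseteq> V \<Longrightarrow> independent_mod s W S \<Longrightarrow> enat (card S) \<le> q"
  shows "qdim s V W \<le> q"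
  unfolding qdim_def using assms by (auto intro: SUP_least)

lemma card_le_qdim:
  assumes "finite S" "S \<subseteq> V" "independent_mod s W S"
  shows "enat (card S) \<le> qdim s V W"
  unfolding qdim_def using assms by (auto intro: SUP_upper)

text \<open>An infinite supremum is not attained, but each finite lower bound is: for n = k + 1 the
  supremum strictly exceeds k, so some admissible set has more than k elements.\<close>

lemma enat_le_qdimE:
  assumes "enat n \<le> qdim s V W"
  obtains S where "finite S" "S \<subseteq> V" "independent_mod s W S" "n \<le> card S"
proof (cases n)
  case 0
  then show ?thesis using that[of "{}"] by (simp add: independent_mod_def)
next
  case (Suc k)
  then have "enat k < qdim s V W"
    using assms by (metis enat_ord_simps(2) lessI order_less_le_trans)
  then show ?thesis
    unfolding qdim_def less_SUP_iff using that Suc by auto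
qed

text \<open>The values of \<open>\<phi>\<close> need only detect linear dependence modulo \<open>W\<close>; \<open>\<phi>\<close> itself need not be linear.\<close>

lemma qdim_le_transfer:
  assumes s': "vector_space s'" and "vector_space s"
    and W': "module.subspace s' W'"
    and maps: "\<And>v. v \<in> V \<Longrightarrow> \<phi> v \<in> V'"
    and refl: "\<And>S a. finite S \<Longrightarrow> S \<subseteq> V \<Longrightarrow> (\<Sum>v\<in>S. s' (a v) (\<phi> v)) \<in> W' \<Longrightarrow>
      (\<Sum>v\<in>S. s (a v) v) \<in> W"
  shows "qdim s V W \<le> qdim s' V' W'"
proof (rule qdim_leI)
  interpret vector_space s' by fact
  fix S assume S: "finite S" "S \<subseteq> V" "independent_mod s W S"
  have *: "\<forall>v\<in>S. a v = 0" if "(\<Sum>v\<in>S. s' (a v) (\<phi> v)) \<in> W'" for a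
    using refl[OF S(1,2) that] S(3) by (simp add: independent_mod_def)
  have inj: "inj_on \<phi> S"
  proof (rule inj_onI, rule ccontr)
    fix v w assume vw: "v \<in> S" "w \<in> S" "\<phi> v = \<phi> w" "v \<noteq> w"
    \<comment> \<open>Two elements with the same image would satisfy the relation with coefficients
      1 and -1, whose value 0 lies in \<open>W'\<close>.\<close>
    let ?a = "\<lambda>x. if x = v then 1 else if x = w then - 1 else 0"
    have "(\<Sum>x\<in>S. s' (?a x) (\<phi> x)) = (\<Sum>x\<in>{v, w}. s' (?a x) (\<phi> x))"
      using S vw by (intro sum.mono_neutral_right) auto
    also have "\<dots> = 0" using vw by simp
    finally have "(\<Sum>x\<in>S. s' (?a x) (\<phi> x)) \<in> W'"
      using subspace_0[OF W'] by simp
    from *[OF this] vw show False by (auto dest: bspec[of _ _ v])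
  qed
  have "independent_mod s' W' (\<phi> ` S)"
    unfolding independent_mod_def
  proof (intro allI impI)
    fix a assume "(\<Sum>v\<in>\<phi> ` S. s' (a v) v) \<in> W'"
    then have "(\<Sum>v\<in>S. s' (a (\<phi> v)) (\<phi> v)) \<in> W'"
      using inj by (simp add: sum.reindex)
    from *[OF this] show "\<forall>v\<in>\<phi> ` S. a v = 0" by simp
  qed
  then have "enat (card (\<phi> ` S)) \<le> qdim s' V' W'"
    using S maps by (intro card_le_qdim) auto
  then show "enat (card S) \<le> qdim s' V' W'"
    using inj by (simp add: card_image)
qed

section \<open>Behaviour of dimensions under linear maps and inclusions\<close>

definition linear_between where
  "linear_between s s' V \<phi> \<longleftrightarrow>
    (\<forall>v\<in>V. \<forall>w\<in>V. \<phi> (v + w) = \<phi> v + \<phi> w) \<and> (\<forall>c. \<forall>v\<in>V. \<phi> (s c v) = s' c (\<phi> v))"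

lemma linear_between_sum:
  assumes "vector_space s" "vector_space s'" and V: "module.subspace s V"
    and lin: "linear_between s s' V \<phi>" and "finite S" "\<And>i. i \<in> S \<Longrightarrow> v i \<in> V"
  shows "\<phi> (\<Sum>i\<in>S. s (a i) (v i)) = (\<Sum>i\<in>S. s' (a i) (\<phi> (v i)))"
proof -
  interpret s: vector_space s by fact
  interpret s': vector_space s' by fact
  show ?thesis
    using assms(5,6)
  proof (induction S)
    case empty
    have "\<phi> (s 0 0) = s' 0 (\<phi> 0)"
      using lin s.subspace_0[OF V] unfolding linear_between_def by blast
    then show ?case by simp
  next
    case (insert i S)
    have "(\<Sum>i\<in>S. s (a i) (v i)) \<in> V"
      using insert.prems by (intro s.subspace_sum[OF V] s.subspace_scale[OF V]) auto
    moreover have "s (a i) (v i) \<in> V" 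
      using insert.prems by (intro s.subspace_scale[OF V]) auto
    ultimately show ?case
      using insert lin by (simp add: linear_between_def)
  qed
qed

text \<open>Independent elements of the image are lifted to arbitrarily chosen preimages. The choice
  is not linear, but applying \<open>\<phi>\<close> to a relation between the preimages returns the
  relation between the images.\<close>

lemma qdim_image_le:
  assumes s: "vector_space s" and s': "vector_space s'"
    and V: "module.subspace s V" and W: "module.subspace s W"
    and lin: "linear_between s s' V \<phi>"
    and W': "\<And>v. v \<in> V \<Longrightarrow> v \<in> W \<Longrightarrow> \<phi> v \<in> W'"
  shows "qdim s' (\<phi> ` V) W' \<le> qdim s V W"
proof (rule qdim_le_transfer[OF s s' W, where \<phi> = "inv_into V \<phi>"])
  interpret s: vector_space s by fact
  fix S a assume *: "finite S" "S \<subseteq> \<phi> ` V" "(\<Sum>v\<in>S. s (a v) (inv_into V \<phi> v)) \<in> W"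
  have V': "inv_into V \<phi> v \<in> V" "\<phi> (inv_into V \<phi> v) = v" if "v \<in> S" for v
    using that *(2) by (auto intro: inv_into_into f_inv_into_f)
  then have "(\<Sum>v\<in>S. s (a v) (inv_into V \<phi> v)) \<in> V"
    by (intro s.subspace_sum[OF V] s.subspace_scale[OF V])
  then have "\<phi> (\<Sum>v\<in>S. s (a v) (inv_into V \<phi> v)) \<in> W'"
    using * W' by blast
  then show "(\<Sum>v\<in>S. s' (a v) v) \<in> W'"
    by (subst (asm) linear_between_sum[OF s s' V lin]) (use * V' in auto)
qed (auto intro: inv_into_into)

text \<open>The equivalence says that \<open>\<phi>\<close> is injective on classes, so independence
  can also be pushed forward.\<close>

lemma qdim_image_eq:
  assumes s: "vector_space s" and s': "vector_space s'"
    and V: "module.subspace s V" and W: "module.subspace s W" and W': "module.subspace s' W'"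
    and lin: "linear_between s s' V \<phi>"
    and iff: "\<And>v. v \<in> V \<Longrightarrow> \<phi> v \<in> W' \<longleftrightarrow> v \<in> W"
  shows "qdim s' (\<phi> ` V) W' = qdim s V W"
proof (rule antisym)
  interpret s: vector_space s by fact
  show "qdim s V W \<le> qdim s' (\<phi> ` V) W'"
  proof (rule qdim_le_transfer[OF s' s W', where \<phi> = \<phi>])
    fix S a assume *: "finite S" "S \<subseteq> V" "(\<Sum>v\<in>S. s' (a v) (\<phi> v)) \<in> W'"
    then have "\<phi> (\<Sum>v\<in>S. s (a v) v) \<in> W'"
      by (subst linear_between_sum[OF s s' V lin]) auto
    moreover have "(\<Sum>v\<in>S. s (a v) v) \<in> V"
      using * by (intro s.subspace_sum[OF V] s.subspace_scale[OF V]) auto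
    ultimately show "(\<Sum>v\<in>S. s (a v) v) \<in> W"
      using iff by blast
  qed simp
qed (use qdim_image_le[OF s s' V W lin] iff in blast)

text \<open>The coefficients that are all 1 already put the sum of a subset of W into W, so only the
  empty set is independent.\<close>

lemma qdim_self:
  assumes "vector_space s" "module.subspace s W"
  shows "qdim s W W = 0"
proof -
  interpret vector_space s by fact
  have "S = {}" if S: "S \<subseteq> W" "independent_mod s W S" for S
  proof -
    have "(\<Sum>v\<in>S. s 1 v) \<in> W"
      using S(1) by (intro subspace_sum[OF assms(2)]) auto
    with S(2) have "\<forall>v\<in>S. (1::'a) = 0"
      unfolding independent_mod_def by (elim allE impE)
    then show ?thesis by auto
  qed
  then have "qdim s W W \<le> 0"
    by (intro qdim_leI) (auto simp: zero_enat_def)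
  then show ?thesis by simp
qed

lemma qdim_mono:
  assumes "V \<subseteq> V'"
  shows "qdim s V W \<le> qdim s V' W"
  unfolding qdim_def using assms by (intro SUP_subset_mono) auto

lemma qdim_antimono:
  assumes "W \<subseteq> W'"
  shows "qdim s V W' \<le> qdim s V W"
  unfolding qdim_def independent_mod_def using assms by (intro SUP_subset_mono) auto

text \<open>The second isomorphism theorem in terms of representatives: V is contained in U + W. The
  chosen u need not depend linearly on v, since every error lies in W.\<close>

lemma qdim_sum_eq:
  assumes s: "vector_space s" and W: "module.subspace s W"
    and "U \<subseteq> V" and cover: "\<And>v. v \<in> V \<Longrightarrow> \<exists>u\<in>U. v - u \<in> W"
  shows "qdim s V W = qdim s U W"
proof (rule antisym)
  interpret vector_space s by fact
  obtain \<phi> where \<phi>: "\<And>v. v \<in> V \<Longrightarrow> \<phi> v \<in> U \<and> v - \<phi> v \<in> W"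
    using cover by metis
  show "qdim s V W \<le> qdim s U W"
  proof (rule qdim_le_transfer[OF s s W, where \<phi> = \<phi>])
    fix S a assume *: "finite S" "S \<subseteq> V" "(\<Sum>v\<in>S. s (a v) (\<phi> v)) \<in> W"
    have "(\<Sum>v\<in>S. s (a v) (v - \<phi> v)) \<in> W"
      using \<phi> * by (intro subspace_sum[OF W] subspace_scale[OF W]) auto
    from subspace_add[OF W this *(3)] show "(\<Sum>v\<in>S. s (a v) v) \<in> W"
      by (simp add: scale_right_diff_distrib sum_subtractf)
  qed (use \<phi> in auto)
qed (rule qdim_mono[OF \<open>U \<subseteq> V\<close>])

text \<open>A relation modulo W is read modulo T first: the part over R disappears, which kills the
  coefficients on S, and what is left is a relation over R modulo W. Disjointness makes the
  cardinalities add.\<close>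

lemma independent_mod_union:
  assumes s: "vector_space s" and T: "module.subspace s T"
    and "W \<subseteq> T" and "finite S" "finite R" "R \<subseteq> T"
    and S: "independent_mod s T S" and R: "independent_mod s W R"
  shows "S \<inter> R = {}" and "independent_mod s W (S \<union> R)"
proof -
  interpret vector_space s by fact
  show disj: "S \<inter> R = {}"
  proof (rule ccontr)
    assume "S \<inter> R \<noteq> {}"
    then obtain v where v: "v \<in> S" "v \<in> R" by blast
    let ?a = "\<lambda>x. if x = v then 1 else 0"
    have "(\<Sum>x\<in>S. s (?a x) x) = (\<Sum>x\<in>S. if x = v then x else 0)"
      by (rule sum.cong) auto
    also have "\<dots> = v" using v \<open>finite S\<close> by simp
    finally have "(\<Sum>x\<in>S. s (?a x) x) \<in> T" using v \<open>R \<subseteq> T\<close> by auto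
    from S[unfolded independent_mod_def, rule_format, OF this v(1)] show False by simp
  qed
  show "independent_mod s W (S \<union> R)"
    unfolding independent_mod_def
  proof (intro allI impI)
    fix a assume "(\<Sum>v\<in>S \<union> R. s (a v) v) \<in> W"
    then have sum: "(\<Sum>v\<in>S. s (a v) v) + (\<Sum>v\<in>R. s (a v) v) \<in> W"
      using \<open>finite S\<close> \<open>finite R\<close> disj by (simp add: sum.union_disjoint)
    moreover have "(\<Sum>v\<in>R. s (a v) v) \<in> T"
      using \<open>R \<subseteq> T\<close> by (intro subspace_sum[OF T] subspace_scale[OF T]) auto
    ultimately have "(\<Sum>v\<in>S. s (a v) v) \<in> T"
      using \<open>W \<subseteq> T\<close> subspace_diff[OF T] by (metis add_diff_cancel_right' subsetD)
    then have S0: "\<forall>v\<in>S. a v = 0" using S by (simp add: independent_mod_def)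
    then have "(\<Sum>v\<in>R. s (a v) v) \<in> W" using sum by simp
    then have "\<forall>v\<in>R. a v = 0" using R by (simp add: independent_mod_def)
    with S0 show "\<forall>v\<in>S \<union> R. a v = 0" by blast
  qed
qed

text \<open>B plays the role of a basis of the span of S modulo T. Since S is finite, a maximal
  independent subset exists by finiteness alone.\<close>

lemma maximal_independent_mod:
  assumes s: "vector_space s" and T: "module.subspace s T" and "finite S"
  obtains B where "B \<subseteq> S" "independent_mod s T B"
    "\<And>v. v \<in> S \<Longrightarrow> \<exists>c. v - (\<Sum>u\<in>B. s (c u) u) \<in> T"
proof -
  interpret vector_space s by fact
  let ?I = "{B. B \<subseteq> S \<and> independent_mod s T B}"
  have "finite ?I" using \<open>finite S\<close> by simp
  moreover have "{} \<in> ?I" by (simp add: independent_mod_def)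
  ultimately obtain B where B: "B \<in> ?I" "\<forall>C\<in>?I. B \<subseteq> C \<longrightarrow> B = C"
    using finite_has_maximal[of ?I] by blast
  then have B: "B \<subseteq> S" "independent_mod s T B"
    and max: "\<And>C. C \<subseteq> S \<Longrightarrow> independent_mod s T C \<Longrightarrow> B \<subseteq> C \<Longrightarrow> B = C"
    by blast+
  have "finite B" using B(1) \<open>finite S\<close> finite_subset by blast
  have "\<exists>c. v - (\<Sum>u\<in>B. s (c u) u) \<in> T" if "v \<in> S" for v
  proof (cases "v \<in> B")
    case True
    have "(\<Sum>u\<in>B. s (if u = v then 1 else 0) u) = (\<Sum>u\<in>B. if u = v then u else 0)"
      by (rule sum.cong) auto
    also have "\<dots> = v" using True \<open>finite B\<close> by simp
    finally have "v - (\<Sum>u\<in>B. s (if u = v then 1 else 0) u) \<in> T"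
      using subspace_0[OF T] by simp
    then show ?thesis by (rule exI[where x = "\<lambda>u. if u = v then 1 else 0"])
  next
    case False
    then have "\<not> independent_mod s T (insert v B)"
      using max[of "insert v B"] B(1) that by blast
    then obtain a where a: "s (a v) v + (\<Sum>u\<in>B. s (a u) u) \<in> T" "\<not> (\<forall>u\<in>insert v B. a u = 0)"
      using False \<open>finite B\<close> by (auto simp: independent_mod_def)
    \<comment> \<open>Otherwise the relation would involve B only and all its coefficients would
      vanish. As \<open>a v\<close> is invertible, the relation can be solved for v.\<close>
    have "a v \<noteq> 0"
      using a B(2) by (auto simp: independent_mod_def)
    have "s (inverse (a v)) (s (a v) v + (\<Sum>u\<in>B. s (a u) u)) \<in> T"
      by (rule subspace_scale[OF T a(1)])
    then have "v - (\<Sum>u\<in>B. s (- (inverse (a v) * a u)) u) \<in> T"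
      using \<open>a v \<noteq> 0\<close> by (simp add: scale_right_distrib scale_sum_right sum_negf)
    then show ?thesis by (rule exI[where x = "\<lambda>u. - (inverse (a v) * a u)"])
  qed
  with B show ?thesis using that by blast
qed

text \<open>For the bound from above, a set S independent modulo W is split into a maximal part B
  independent modulo T and the rest; each remaining vector is moved into T by subtracting a
  combination of B.\<close>

lemma qdim_additive:
  assumes s: "vector_space s" and W: "module.subspace s W" and T: "module.subspace s T"
    and V: "module.subspace s V" and "W \<subseteq> T" "T \<subseteq> V"
  shows "qdim s V W = qdim s V T + qdim s T W"
proof (rule antisym)
  interpret vector_space s by fact
  show "qdim s V T + qdim s T W \<le> qdim s V W"
  proof (rule enat_add_leI)
    fix m n assume "enat m \<le> qdim s V T" "enat n \<le> qdim s T W"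
    then obtain S R where S: "finite S" "S \<subseteq> V" "independent_mod s T S" "m \<le> card S"
      and R: "finite R" "R \<subseteq> T" "independent_mod s W R" "n \<le> card R"
      by (meson enat_le_qdimE)
    note union = independent_mod_union[OF s T \<open>W \<subseteq> T\<close> S(1) R(1,2) S(3) R(3)]
    have "enat (m + n) \<le> enat (card (S \<union> R))"
      using S R union(1) by (simp add: card_Un_disjoint)
    also have "\<dots> \<le> qdim s V W"
      using S R union \<open>T \<subseteq> V\<close> by (intro card_le_qdim) auto
    finally show "enat (m + n) \<le> qdim s V W" .
  qed
  show "qdim s V W \<le> qdim s V T + qdim s T W"
  proof (rule qdim_leI)
    fix S assume S: "finite S" "S \<subseteq> V" "independent_mod s W S"
    obtain B where B: "B \<subseteq> S" "independent_mod s T B"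
      "\<And>v. v \<in> S \<Longrightarrow> \<exists>c. v - (\<Sum>u\<in>B. s (c u) u) \<in> T"
      using maximal_independent_mod[OF s T S(1)] by metis
    then obtain c where c: "\<And>v. v \<in> S \<Longrightarrow> v - (\<Sum>u\<in>B. s (c v u) u) \<in> T"
      by metis
    have "finite B" using B(1) S(1) finite_subset by blast
    define \<phi> where "\<phi> = (\<lambda>v. v - (\<Sum>u\<in>B. s (c v u) u))"
    \<comment> \<open>W plus the span of B. The correction terms in \<open>\<phi>\<close> vanish
      modulo this space, so independence of \<open>S - B\<close> modulo it is what carries over to
      the corrected vectors modulo W.\<close>
    define W' where "W' = {w. \<exists>b. w + (\<Sum>u\<in>B. s (b u) u) \<in> W}"
    have "independent_mod s W' (S - B)"
      unfolding independent_mod_def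
    proof (intro allI impI)
      fix a assume "(\<Sum>v\<in>S - B. s (a v) v) \<in> W'"
      then obtain b where "(\<Sum>v\<in>S - B. s (a v) v) + (\<Sum>u\<in>B. s (b u) u) \<in> W"
        by (auto simp: W'_def)
      moreover define d where "d = (\<lambda>v. if v \<in> B then b v else a v)"
      moreover have "(\<Sum>v\<in>S. s (d v) v) = (\<Sum>v\<in>S - B. s (d v) v) + (\<Sum>v\<in>B. s (d v) v)"
        by (rule sum.subset_diff[OF B(1) S(1)])
      ultimately have "(\<Sum>v\<in>S. s (d v) v) \<in> W"
        by simp
      then have "\<forall>v\<in>S. d v = 0"
        using S(3) by (simp add: independent_mod_def)
      then show "\<forall>v\<in>S - B. a v = 0" by (auto simp: d_def)
    qed
    then have "enat (card (S - B)) \<le> qdim s (S - B) W'"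
      using S by (intro card_le_qdim) auto
    also have "\<dots> \<le> qdim s T W"
    proof (rule qdim_le_transfer[OF s s W, where \<phi> = \<phi>])
      show "\<phi> v \<in> T" if "v \<in> S - B" for v using c that by (simp add: \<phi>_def)
    next
      fix R a assume R: "finite R" "R \<subseteq> S - B" "(\<Sum>v\<in>R. s (a v) (\<phi> v)) \<in> W"
      have "(\<Sum>v\<in>R. s (a v) (\<phi> v)) = (\<Sum>v\<in>R. s (a v) v) - (\<Sum>v\<in>R. \<Sum>u\<in>B. s (a v * c v u) u)"
        by (simp add: \<phi>_def scale_right_diff_distrib sum_subtractf scale_sum_right)
      also have "(\<Sum>v\<in>R. \<Sum>u\<in>B. s (a v * c v u) u) = (\<Sum>u\<in>B. s (\<Sum>v\<in>R. a v * c v u) u)"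
        by (subst sum.swap) (simp add: scale_sum_left)
      finally have "(\<Sum>v\<in>R. s (a v) v) + (\<Sum>u\<in>B. s (- (\<Sum>v\<in>R. a v * c v u)) u) \<in> W"
        using R(3) by (simp add: sum_negf)
      then show "(\<Sum>v\<in>R. s (a v) v) \<in> W'"
        unfolding W'_def mem_Collect_eq
        by (rule exI[where x = "\<lambda>u. - (\<Sum>v\<in>R. a v * c v u)"])
    qed
    finally have "enat (card (S - B)) \<le> qdim s T W" .
    moreover have "enat (card B) \<le> qdim s V T"
      using B S \<open>finite B\<close> by (intro card_le_qdim) auto
    moreover have "card S = card B + card (S - B)"
      using B(1) S(1) \<open>finite B\<close> by (simp add: card_Diff_subset card_mono)
    ultimately show "enat (card S) \<le> qdim s V T + qdim s T W"
      by (metis add_mono plus_enat_simps(1))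
  qed
qed

section \<open>From sets of cosets to sets of representatives\<close>

lemma class_dim_eq_qdim: "class_dim s W K = qdim s (\<Union>K) W"
  by (simp add: class_dim_def qdim_def)

lemma Union_quotient_space:
  assumes "vector_space s" "module.subspace s V" "module.subspace s W" "W \<subseteq> V"
  shows "\<Union>(quotient_space V W) = V"
proof -
  interpret vector_space s by fact
  have "u \<in> V" if "v \<in> V" "u - v \<in> W" for u v
    using subspace_add[OF assms(2), of "u - v" v] that assms(4) by auto
  moreover have "u - u \<in> W" for u using subspace_0[OF assms(3)] by simp
  ultimately show ?thesis
    unfolding quotient_space_def coset_def by blast
qed

lemma quotient_dim_eq_qdim:
  assumes "vector_space s" "module.subspace s V" "module.subspace s W" "W \<subseteq> V"
  shows "quotient_dim s V W = qdim s V W"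
  by (simp add: quotient_dim_def class_dim_eq_qdim Union_quotient_space[OF assms])


section \<open>Calculus of holomorphic germs\<close>

lemma eventually_nhds_compose:
  assumes "\<forall>\<^sub>F y in nhds (a 0). P y" "isCont a 0"
  shows "\<forall>\<^sub>F z in nhds 0. P (a z)"
  using assms tendsto_at_iff_tendsto_nhds[of a 0] unfolding isCont_def filterlim_iff by blast

lemma holomorphic_at_0_cong:
  assumes "\<forall>\<^sub>F z in nhds 0. u z = v z" "holomorphic_at_0 u"
  shows "holomorphic_at_0 v"
proof -
  \<comment> \<open>Derivatives at a nearby point z depend on a whole neighbourhood of z, so
    agreement near 0 is first spread to agreement near each nearby point.\<close>
  have "\<forall>\<^sub>F z in nhds 0. \<forall>\<^sub>F y in nhds z. u y = v y"
    using assms(1) by (simp add: eventually_eventually)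
  then show ?thesis
    using assms(2) unfolding holomorphic_at_0_def
  proof eventually_elim
    case (elim z)
    then show ?case
      using has_derivative_transform_eventually[of u _ z UNIV v] eventually_nhds_x_imp_x
      by (force simp: eventually_nhds_conv_at)
  qed
qed

lemma holomorphic_at_0_const: "holomorphic_at_0 (\<lambda>_. c)"
  unfolding holomorphic_at_0_def
  by (intro always_eventually allI exI[of _ "\<lambda>_. 0"]) (simp add: complex_linear_iff)

lemma holomorphic_at_0_nth: "holomorphic_at_0 (\<lambda>z. z $ i)"
  unfolding holomorphic_at_0_def
  by (intro always_eventually allI exI[of _ "\<lambda>z. z $ i"])
    (simp add: complex_linear_iff bounded_linear_imp_has_derivative bounded_linear_vec_nth)

lemma holomorphic_at_0_add:
  assumes "holomorphic_at_0 u" "holomorphic_at_0 v"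
  shows "holomorphic_at_0 (\<lambda>z. u z + v z)"
  using assms unfolding holomorphic_at_0_def
proof eventually_elim
  case (elim z)
  then obtain D E where "(u has_derivative D) (at z)" "(v has_derivative E) (at z)"
    "Vector_Spaces.linear (*s) (*) D" "Vector_Spaces.linear (*s) (*) E" by blast
  then show ?case
    by (intro exI[of _ "\<lambda>h. D h + E h"] conjI has_derivative_add)
      (simp_all add: complex_linear_iff algebra_simps)
qed

lemma holomorphic_at_0_mult:
  assumes "holomorphic_at_0 u" "holomorphic_at_0 v"
  shows "holomorphic_at_0 (\<lambda>z. u z * v z)"
  using assms unfolding holomorphic_at_0_def
proof eventually_elim
  case (elim z)
  then obtain D E where "(u has_derivative D) (at z)" "(v has_derivative E) (at z)"
    "Vector_Spaces.linear (*s) (*) D" "Vector_Spaces.linear (*s) (*) E" by blast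
  then show ?case
    by (intro exI[of _ "\<lambda>h. u z * E h + D h * v z"] conjI has_derivative_mult)
      (simp_all add: complex_linear_iff algebra_simps)
qed

lemma holomorphic_at_0_sum:
  assumes "\<And>i. i \<in> I \<Longrightarrow> holomorphic_at_0 (u i)"
  shows "holomorphic_at_0 (\<lambda>z. \<Sum>i\<in>I. u i z)"
  using assms
  by (induction I rule: infinite_finite_induct) (auto intro: holomorphic_at_0_const holomorphic_at_0_add)

text \<open>The derivatives of the finitely many components assemble to one of f, and uniqueness
  identifies it with the real derivative used in \<open>differential\<close>, which is therefore
  complex homogeneous.\<close>

lemma eventually_has_derivative:
  assumes "holomorphic_map_at_0 f"
  shows "\<forall>\<^sub>F z in nhds 0. (f has_derivative differential f z) (at z) \<and>
    (\<forall>c h. differential f z (c *s h) = c *s differential f z h)"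
proof -
  have "\<forall>\<^sub>F z in nhds 0. \<forall>j. \<exists>D. ((\<lambda>z. f z $ j) has_derivative D) (at z) \<and>
      Vector_Spaces.linear (*s) (*) D"
    using assms unfolding holomorphic_map_at_0_def holomorphic_at_0_def
    by (simp add: eventually_all_finite)
  then show ?thesis
  proof eventually_elim
    case (elim z)
    then obtain D where D: "\<And>j. ((\<lambda>z. f z $ j) has_derivative D j) (at z)"
      "\<And>j. Vector_Spaces.linear (*s) (*) (D j)" by metis
    have der: "(f has_derivative (\<lambda>h. \<chi> j. D j h)) (at z)"
      unfolding has_derivative_componentwise_within[of f]
    proof
      fix i :: "complex^'b" assume "i \<in> Basis"
      then obtain j b where "i = axis j b" by (auto simp: Basis_vec_def)
      then show "((\<lambda>x. f x \<bullet> i) has_derivative (\<lambda>x. (\<chi> j. D j x) \<bullet> i)) (at z)"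
        using has_derivative_inner_left[OF D(1)[of j], of b] by (simp add: inner_axis)
    qed
    have eq: "differential f z = (\<lambda>h. \<chi> j. D j h)"
      using frechet_derivative_at[OF der] by simp
    show ?case
      unfolding eq using der D(2) by (simp add: complex_linear_iff vec_eq_iff)
  qed
qed

lemma eventually_linear_differential:
  assumes "holomorphic_map_at_0 f"
  shows "\<forall>\<^sub>F z in nhds 0. linear (differential f z) \<and>
    (\<forall>c h. differential f z (c *s h) = c *s differential f z h)"
  using eventually_has_derivative[OF assms]
  by eventually_elim (blast intro: has_derivative_linear)

lemma holomorphic_map_at_0I:
  assumes "\<forall>\<^sub>F z in nhds 0. (f has_derivative D z) (at z) \<and> (\<forall>c h. D z (c *s h) = c *s D z h)"
  shows "holomorphic_map_at_0 f"
  unfolding holomorphic_map_at_0_def holomorphic_at_0_def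
proof
  fix j
  show "\<forall>\<^sub>F z in nhds 0. \<exists>E. ((\<lambda>z. f z $ j) has_derivative E) (at z) \<and> Vector_Spaces.linear (*s) (*) E"
    using assms
  proof eventually_elim
    case (elim z)
    then have "linear (D z)" using has_derivative_linear by blast
    with elim show ?case
      by (intro exI[of _ "\<lambda>h. D z h $ j"])
        (auto simp: complex_linear_iff linear_add
          intro: bounded_linear.has_derivative[OF bounded_linear_vec_nth])
  qed
qed

lemma holomorphic_map_isCont:
  assumes "holomorphic_map_at_0 f"
  shows "isCont f 0"
proof -
  from eventually_nhds_x_imp_x[OF eventually_has_derivative[OF assms]]
  have "(f has_derivative differential f 0) (at 0)" ..
  then show ?thesis by (rule has_derivative_continuous)
qed

lemma eventually_compose:
  assumes "holomorphic_map_at_0 a" "a 0 = 0" "\<forall>\<^sub>F y in nhds 0. P y"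
  shows "\<forall>\<^sub>F z in nhds 0. P (a z)"
  using eventually_nhds_compose[where a = a and P = P] holomorphic_map_isCont[OF assms(1)] assms by simp

lemma holomorphic_map_compose:
  assumes a: "holomorphic_map_at_0 a" "a 0 = 0" and b: "holomorphic_map_at_0 b"
  shows "holomorphic_map_at_0 (\<lambda>z. b (a z))"
    and "\<forall>\<^sub>F z in nhds 0. differential (\<lambda>z. b (a z)) z = (\<lambda>h. differential b (a z) (differential a z h))"
proof -
  have *: "\<forall>\<^sub>F z in nhds 0.
      ((\<lambda>z. b (a z)) has_derivative (\<lambda>h. differential b (a z) (differential a z h))) (at z) \<and>
      (\<forall>c h. differential b (a z) (differential a z (c *s h)) = c *s differential b (a z) (differential a z h))"
    using eventually_has_derivative[OF a(1)] eventually_compose[OF a eventually_has_derivative[OF b]]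
    by eventually_elim (auto intro: has_derivative_compose)
  show "holomorphic_map_at_0 (\<lambda>z. b (a z))"
    using holomorphic_map_at_0I[OF *] .
  show "\<forall>\<^sub>F z in nhds 0. differential (\<lambda>z. b (a z)) z = (\<lambda>h. differential b (a z) (differential a z h))"
    using * by eventually_elim (metis frechet_derivative_at)
qed

lemma holomorphic_at_0_compose:
  fixes u :: "complex^'p \<Rightarrow> complex"
  assumes "holomorphic_map_at_0 a" "a 0 = 0" "holomorphic_at_0 u"
  shows "holomorphic_at_0 (\<lambda>z. u (a z))"
  \<comment> \<open>A scalar function is read as a map into the one-dimensional space
    \<open>complex^1\<close>, so that the chain rule for maps applies.\<close>
  using holomorphic_map_compose(1)[OF assms(1,2), of "\<lambda>y. (\<chi> _. u y) :: complex^1"] assms(3)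
  by (simp add: holomorphic_map_at_0_def)

lemma differential_cong:
  assumes "\<forall>\<^sub>F z in nhds 0. f z = g z" "holomorphic_map_at_0 f"
  shows "\<forall>\<^sub>F z in nhds 0. differential f z = differential g z"
proof -
  have "\<forall>\<^sub>F z in nhds 0. \<forall>\<^sub>F y in nhds z. f y = g y"
    using assms(1) by (simp add: eventually_eventually)
  then show ?thesis
    using eventually_has_derivative[OF assms(2)]
  proof eventually_elim
    case (elim z)
    then have "(g has_derivative differential f z) (at z)"
      using has_derivative_transform_eventually[of f _ z UNIV g] eventually_nhds_x_imp_x
      by (force simp: eventually_nhds_conv_at)
    then show ?case by (rule frechet_derivative_at)
  qed
qed

text \<open>For e a basis vector these are the entries of the Jacobian matrix; the Cauchy argument
  enters the theory of germs here.\<close>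

lemma holomorphic_at_0_differential:
  assumes "holomorphic_map_at_0 f"
  shows "holomorphic_at_0 (\<lambda>z. differential f z e $ j)"
proof -
  obtain S where S: "open S" "0 \<in> S"
    and D: "\<And>z. z \<in> S \<Longrightarrow> (f has_derivative differential f z) (at z) \<and>
      (\<forall>c h. differential f z (c *s h) = c *s differential f z h)"
    using eventually_has_derivative[OF assms] unfolding eventually_nhds by blast
  have "\<exists>E. ((\<lambda>z. differential f z e $ j) has_derivative E) (at z) \<and> Vector_Spaces.linear (*s) (*) E"
    if "z \<in> S" for z
  proof (rule directional_derivative_holomorphic[OF S(1) _ _ that, of "\<lambda>z. f z $ j" "\<lambda>z h. differential f z h $ j"])
    fix y assume "y \<in> S"
    note D = D[OF this]
    show "((\<lambda>z. f z $ j) has_derivative (\<lambda>h. differential f y h $ j)) (at y)"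
      using D by (auto intro: bounded_linear.has_derivative[OF bounded_linear_vec_nth])
    show "Vector_Spaces.linear (*s) (*) (\<lambda>h. differential f y h $ j)"
      using D linear_add[OF has_derivative_linear, of f "differential f y"]
      by (simp add: complex_linear_iff) (metis vector_add_component)
  qed
  with S show ?thesis
    unfolding holomorphic_at_0_def eventually_nhds by blast
qed

text \<open>Expanding \<open>v z\<close> in the standard basis turns the value into sums of products
  of components of v with Jacobian entries composed with a. The base point a is general because
  A-equivalence moves it; the identity gives the fields df(\<epsilon>).\<close>

lemma holomorphic_map_differential:
  assumes f: "holomorphic_map_at_0 f" and a: "holomorphic_map_at_0 a" "a 0 = 0"
    and v: "holomorphic_map_at_0 v"
  shows "holomorphic_map_at_0 (\<lambda>z. differential f (a z) (v z))"
  unfolding holomorphic_map_at_0_def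
proof
  fix j
  have "\<forall>\<^sub>F z in nhds 0. (\<Sum>i\<in>UNIV. v z $ i * differential f (a z) (axis i 1) $ j)
      = differential f (a z) (v z) $ j"
    using eventually_compose[OF a eventually_has_derivative[OF f]]
  proof eventually_elim
    case (elim z)
    then have lin: "linear (differential f (a z))" using has_derivative_linear by blast
    have "differential f (a z) (v z) = differential f (a z) (\<Sum>i\<in>UNIV. v z $ i *s axis i 1)"
      by (simp add: basis_expansion)
    also have "\<dots> = (\<Sum>i\<in>UNIV. v z $ i *s differential f (a z) (axis i 1))"
      using elim by (simp add: linear_sum[OF lin])
    finally show ?case by simp
  qed
  moreover have "holomorphic_at_0 (\<lambda>z. \<Sum>i\<in>UNIV. v z $ i * differential f (a z) (axis i 1) $ j)"
    using v holomorphic_at_0_compose[OF a holomorphic_at_0_differential[OF f]]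
    by (intro holomorphic_at_0_sum holomorphic_at_0_mult) (auto simp: holomorphic_map_at_0_def)
  ultimately show "holomorphic_at_0 (\<lambda>z. differential f (a z) (v z) $ j)"
    by (rule holomorphic_at_0_cong)
qed

lemma holomorphic_map_add:
  assumes "holomorphic_map_at_0 u" "holomorphic_map_at_0 v"
  shows "holomorphic_map_at_0 (\<lambda>z. u z + v z)"
  using assms by (simp add: holomorphic_map_at_0_def holomorphic_at_0_add)

lemma holomorphic_map_scale:
  assumes "holomorphic_map_at_0 u"
  shows "holomorphic_map_at_0 (\<lambda>z. c *s u z)"
  using assms by (simp add: holomorphic_map_at_0_def holomorphic_at_0_mult holomorphic_at_0_const)

lemma holomorphic_map_zero: "holomorphic_map_at_0 (\<lambda>_. 0)"
  by (simp add: holomorphic_map_at_0_def holomorphic_at_0_const)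


section \<open>Linear algebra of germs\<close>

lemma germ_cases:
  obtains u where "x = germ_of u"
  by (induct x rule: germ.abs_induct) blast

lemma germ_of_eq_iff: "germ_of u = germ_of v \<longleftrightarrow> (\<forall>\<^sub>F z in nhds 0. u z = v z)"
  by (rule germ.abs_eq_iff)

lemma eventually_rep_germ: "\<forall>\<^sub>F z in nhds 0. rep_germ (germ_of u) z = u z"
  using Quotient3_rep_abs[OF Quotient3_germ] germ.abs_eq_iff by blast

lemmas vector_space_map_germs = vector_space_germ_scale[OF vec.vector_space_axioms]
lemmas vector_space_function_germs =
  vector_space_germ_scale[OF vector_space_over_itself.vector_space_axioms]

interpretation map_germs: vector_space
  "germ_scale (*s) :: complex \<Rightarrow> ('a::{topological_space, zero}, complex^'p) germ \<Rightarrow> ('a, complex^'p) germ"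
  by (rule vector_space_map_germs)

interpretation function_germs: vector_space
  "germ_scale (*) :: complex \<Rightarrow> ('a::{topological_space, zero}, complex) germ \<Rightarrow> ('a, complex) germ"
  by (rule vector_space_function_germs)

text \<open>Independent of the representative only when \<open>r\<close> is continuous and fixes 0.\<close>

definition germ_transport ::
    "('a \<Rightarrow> 'b \<Rightarrow> 'd) \<Rightarrow> ('a \<Rightarrow> 'c) \<Rightarrow> ('c::{topological_space, zero}, 'b) germ
      \<Rightarrow> ('a::{topological_space, zero}, 'd) germ" where
  "germ_transport L r x = germ_of (\<lambda>z. L z (rep_germ x (r z)))"

lemma germ_transport_of:
  assumes "isCont r 0" "r 0 = 0"
  shows "germ_transport L r (germ_of v) = germ_of (\<lambda>z. L z (v (r z)))"
proof -
  have "\<forall>\<^sub>F z in nhds 0. rep_germ (germ_of v) (r z) = v (r z)"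
    by (rule eventually_nhds_compose[where a = r and P = "\<lambda>y. rep_germ (germ_of v) y = v y"])
      (simp_all add: assms eventually_rep_germ)
  then show ?thesis
    unfolding germ_transport_def germ_of_eq_iff by eventually_elim simp
qed

lemma linear_germ_transport:
  fixes r :: "'a::{t2_space, zero} \<Rightarrow> 'c::{topological_space, zero}"
    and s :: "'k::field \<Rightarrow> 'b::ab_group_add \<Rightarrow> 'b" and s' :: "'k \<Rightarrow> 'd::ab_group_add \<Rightarrow> 'd"
  assumes r: "isCont r 0" "r 0 = 0"
    and L: "\<forall>\<^sub>F z in nhds 0. (\<forall>x y. L z (x + y) = L z x + L z y) \<and> (\<forall>c x. L z (s c x) = s' c (L z x))"
  shows "linear_between (germ_scale s) (germ_scale s') V (germ_transport L r)"
  unfolding linear_between_def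
proof (intro conjI ballI allI)
  fix v w :: "('c, 'b) germ" and c
  obtain u u' where [simp]: "v = germ_of u" "w = germ_of u'"
    by (metis germ_cases)
  show "germ_transport L r (v + w) = germ_transport L r v + germ_transport L r w"
    using L by (auto simp: germ_transport_of[OF r] plus_germ.abs_eq germ_of_eq_iff elim: eventually_mono)
  show "germ_transport L r (germ_scale s c v) = germ_scale s' c (germ_transport L r v)"
    using L by (auto simp: germ_transport_of[OF r] germ_scale.abs_eq germ_of_eq_iff elim: eventually_mono)
qed

text \<open>Membership in \<open>theta\<close> only promises some holomorphic representative;
  holomorphy near 0 survives a change of representative, so the given one is holomorphic
  too.\<close>

lemma germ_of_in_theta: "germ_of v \<in> theta \<longleftrightarrow> holomorphic_map_at_0 v"
proof
  assume "germ_of v \<in> theta"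
  then obtain w where w: "germ_of v = germ_of w" "holomorphic_map_at_0 w"
    by (auto simp: theta_def)
  from w(1) have ev: "\<forall>\<^sub>F z in nhds 0. w z = v z"
    unfolding germ_of_eq_iff by (simp add: eq_commute)
  show "holomorphic_map_at_0 v"
    unfolding holomorphic_map_at_0_def
  proof
    fix j
    show "holomorphic_at_0 (\<lambda>z. v z $ j)"
      by (rule holomorphic_at_0_cong[of "\<lambda>z. w z $ j"])
        (use w(2) ev in \<open>auto simp: holomorphic_map_at_0_def elim: eventually_mono\<close>)
  qed
qed (auto simp: theta_def)

lemma germ_of_in_function_germs: "germ_of v \<in> function_germs \<longleftrightarrow> holomorphic_at_0 v"
proof
  assume "germ_of v \<in> function_germs"
  then obtain w where "germ_of v = germ_of w" "holomorphic_at_0 w"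
    by (auto simp: function_germs_def)
  then show "holomorphic_at_0 v"
    using holomorphic_at_0_cong[of w v] by (simp add: germ_of_eq_iff eq_commute)
qed (auto simp: function_germs_def)

lemma thetaE:
  assumes "x \<in> theta"
  obtains v where "x = germ_of v" "holomorphic_map_at_0 v"
  using assms by (auto simp: theta_def)

lemma subspace_theta: "map_germs.subspace theta"
  unfolding map_germs.subspace_def
proof (intro conjI ballI allI)
  show "0 \<in> theta"
    by (simp add: zero_germ_def germ_of_in_theta holomorphic_map_zero)
next
  fix x y :: "(complex^'a, complex^'b) germ" assume "x \<in> theta" "y \<in> theta"
  then show "x + y \<in> theta"
    by (elim thetaE) (simp add: plus_germ.abs_eq germ_of_in_theta holomorphic_map_add)
next
  fix c and x :: "(complex^'a, complex^'b) germ" assume "x \<in> theta"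
  then show "germ_scale (*s) c x \<in> theta"
    by (elim thetaE) (simp add: germ_scale.abs_eq germ_of_in_theta holomorphic_map_scale)
qed

lemma function_germsE:
  assumes "x \<in> function_germs"
  obtains v where "x = germ_of v" "holomorphic_at_0 v"
  using assms by (auto simp: function_germs_def)

lemma subspace_function_germs: "function_germs.subspace function_germs"
  unfolding function_germs.subspace_def
proof (intro conjI ballI allI)
  show "0 \<in> function_germs"
    by (simp add: zero_germ_def germ_of_in_function_germs holomorphic_at_0_const)
next
  fix x y :: "(complex^'a, complex) germ" assume "x \<in> function_germs" "y \<in> function_germs"
  then show "x + y \<in> function_germs"
    by (elim function_germsE) (simp add: plus_germ.abs_eq germ_of_in_function_germs holomorphic_at_0_add)
next
  fix c and x :: "(complex^'a, complex) germ" assume "x \<in> function_germs"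
  then show "germ_scale (*) c x \<in> function_germs"
    by (elim function_germsE) (simp add: germ_scale.abs_eq germ_of_in_function_germs
        holomorphic_at_0_mult[OF holomorphic_at_0_const])
qed

section \<open>The extended tangent space as a subspace of \<open>theta\<close>\<close>

lemma TAe_I:
  assumes "holomorphic_map_at_0 \<epsilon>" "holomorphic_map_at_0 \<eta>"
    and "\<forall>\<^sub>F z in nhds 0. v z = differential f z (\<epsilon> z) + \<eta> (f z)"
  shows "germ_of v \<in> TAe f"
  using assms unfolding TAe_def germ_of_eq_iff[symmetric] by blast

lemma TAe_E:
  assumes "x \<in> TAe f"
  obtains \<epsilon> \<eta> where "holomorphic_map_at_0 \<epsilon>" "holomorphic_map_at_0 \<eta>"
    "x = germ_of (\<lambda>z. differential f z (\<epsilon> z) + \<eta> (f z))"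
  using assms unfolding TAe_def by blast

lemma TAe_subset_theta:
  assumes "map_germ f"
  shows "TAe f \<subseteq> theta"
proof
  fix x assume "x \<in> TAe f"
  then obtain \<epsilon> \<eta> where hol: "holomorphic_map_at_0 \<epsilon>" "holomorphic_map_at_0 \<eta>"
    and x: "x = germ_of (\<lambda>z. differential f z (\<epsilon> z) + \<eta> (f z))"
    by (rule TAe_E)
  have f: "holomorphic_map_at_0 f" "f 0 = 0" using assms by (auto simp: map_germ_def)
  have id: "holomorphic_map_at_0 (\<lambda>z. z)"
    by (simp add: holomorphic_map_at_0_def holomorphic_at_0_nth)
  have "holomorphic_map_at_0 (\<lambda>z. differential f z (\<epsilon> z))"
    using holomorphic_map_differential[OF f(1) id _ hol(1)] by simp
  moreover have "holomorphic_map_at_0 (\<lambda>z. \<eta> (f z))"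
    by (rule holomorphic_map_compose(1)[OF f hol(2)])
  ultimately show "x \<in> theta"
    unfolding x germ_of_in_theta by (rule holomorphic_map_add)
qed

lemma subspace_TAe:
  assumes "map_germ f"
  shows "map_germs.subspace (TAe f)"
proof -
  have f: "\<forall>\<^sub>F z in nhds 0. linear (differential f z) \<and>
      (\<forall>c h. differential f z (c *s h) = c *s differential f z h)"
    using assms eventually_linear_differential by (auto simp: map_germ_def)
  show ?thesis
    unfolding map_germs.subspace_def
  proof (intro conjI ballI allI)
    show "0 \<in> TAe f"
      unfolding zero_germ_def
    proof (rule TAe_I[OF holomorphic_map_zero holomorphic_map_zero])
      show "\<forall>\<^sub>F z in nhds 0. 0 = differential f z 0 + 0"
        using f by eventually_elim (simp add: linear_0)
    qed
  next
    fix x y assume "x \<in> TAe f" "y \<in> TAe f"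
    from \<open>x \<in> TAe f\<close> obtain \<epsilon> \<eta> where hol: "holomorphic_map_at_0 \<epsilon>" "holomorphic_map_at_0 \<eta>"
      and x: "x = germ_of (\<lambda>z. differential f z (\<epsilon> z) + \<eta> (f z))"
      by (rule TAe_E)
    from \<open>y \<in> TAe f\<close> obtain \<epsilon>' \<eta>' where hol': "holomorphic_map_at_0 \<epsilon>'" "holomorphic_map_at_0 \<eta>'"
      and y: "y = germ_of (\<lambda>z. differential f z (\<epsilon>' z) + \<eta>' (f z))"
      by (rule TAe_E)
    show "x + y \<in> TAe f"
      unfolding x y plus_germ.abs_eq
    proof (rule TAe_I[OF holomorphic_map_add[OF hol(1) hol'(1)] holomorphic_map_add[OF hol(2) hol'(2)]])
      show "\<forall>\<^sub>F z in nhds 0. differential f z (\<epsilon> z) + \<eta> (f z) + (differential f z (\<epsilon>' z) + \<eta>' (f z))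
          = differential f z (\<epsilon> z + \<epsilon>' z) + (\<eta> (f z) + \<eta>' (f z))"
        using f by eventually_elim (simp add: linear_add)
    qed
  next
    fix c x assume "x \<in> TAe f"
    then obtain \<epsilon> \<eta> where hol: "holomorphic_map_at_0 \<epsilon>" "holomorphic_map_at_0 \<eta>"
      and x: "x = germ_of (\<lambda>z. differential f z (\<epsilon> z) + \<eta> (f z))"
      by (rule TAe_E)
    show "germ_scale (*s) c x \<in> TAe f"
      unfolding x germ_scale.abs_eq
    proof (rule TAe_I[OF holomorphic_map_scale[OF hol(1)] holomorphic_map_scale[OF hol(2)]])
      show "\<forall>\<^sub>F z in nhds 0. c *s (differential f z (\<epsilon> z) + \<eta> (f z))
          = differential f z (c *s \<epsilon> z) + c *s \<eta> (f z)"
        using f by eventually_elim (simp add: vector_add_ldistrib)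
    qed
  qed
qed

section \<open>The algebra of pulled-back function germs\<close>

lemma pullback_germs_I:
  assumes "holomorphic_at_0 u" "\<forall>\<^sub>F z in nhds 0. v z = u (f z)"
  shows "germ_of v \<in> pullback_germs f"
  using assms unfolding pullback_germs_def germ_of_eq_iff[symmetric] by blast

lemma pullback_germs_E:
  assumes "x \<in> pullback_germs f"
  obtains u where "holomorphic_at_0 u" "x = germ_of (\<lambda>z. u (f z))"
  using assms unfolding pullback_germs_def by blast

lemma pullback_germs_subset:
  assumes "map_germ f"
  shows "pullback_germs f \<subseteq> function_germs"
proof
  fix x assume "x \<in> pullback_germs f"
  then obtain u where u: "holomorphic_at_0 u" "x = germ_of (\<lambda>z. u (f z))"
    by (rule pullback_germs_E)
  with holomorphic_at_0_compose[of f u] assms show "x \<in> function_germs"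
    by (simp add: map_germ_def germ_of_in_function_germs)
qed

lemma subspace_pullback_germs: "function_germs.subspace (pullback_germs f)"
  unfolding function_germs.subspace_def
proof (intro conjI ballI allI)
  show "0 \<in> pullback_germs f"
    unfolding zero_germ_def by (rule pullback_germs_I[OF holomorphic_at_0_const[of 0]]) simp
next
  fix x y assume "x \<in> pullback_germs f" "y \<in> pullback_germs f"
  then obtain u v where hol: "holomorphic_at_0 u" "holomorphic_at_0 v"
    and xy: "x = germ_of (\<lambda>z. u (f z))" "y = germ_of (\<lambda>z. v (f z))"
    by (metis pullback_germs_E)
  show "x + y \<in> pullback_germs f"
    unfolding xy plus_germ.abs_eq
    by (rule pullback_germs_I[OF holomorphic_at_0_add[OF hol]]) simp
next
  fix c x assume "x \<in> pullback_germs f"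
  then obtain u where hol: "holomorphic_at_0 u" and x: "x = germ_of (\<lambda>z. u (f z))"
    by (metis pullback_germs_E)
  show "germ_scale (*) c x \<in> pullback_germs f"
    unfolding x germ_scale.abs_eq
    by (rule pullback_germs_I[OF holomorphic_at_0_mult[OF holomorphic_at_0_const[of c] hol]]) simp
qed

lemma Ae_cod_eq_qdim:
  assumes "map_germ f"
  shows "Ae_cod f = qdim (germ_scale (*s)) theta (TAe f)"
  unfolding Ae_cod_def
  by (rule quotient_dim_eq_qdim[OF vector_space_map_germs subspace_theta subspace_TAe[OF assms]
        TAe_subset_theta[OF assms]])

lemma delta_eq_qdim:
  assumes "map_germ f"
  shows "delta f = qdim (germ_scale (*)) function_germs (pullback_germs f)"
  unfolding delta_def
  by (rule quotient_dim_eq_qdim[OF vector_space_function_germs subspace_function_germs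
        subspace_pullback_germs pullback_germs_subset[OF assms]])


section \<open>Invariance under \<open>\<A>\<close>-equivalence\<close>

lemma inverse_biholomorphisms_sym:
  "inverse_biholomorphisms \<phi> \<phi>' \<Longrightarrow> inverse_biholomorphisms \<phi>' \<phi>"
  by (simp add: inverse_biholomorphisms_def)

lemma eventually_compose_map_germ:
  assumes "map_germ a" "\<forall>\<^sub>F y in nhds 0. P y"
  shows "\<forall>\<^sub>F z in nhds 0. P (a z)"
  using assms eventually_compose[where a = a and P = P] by (simp add: map_germ_def)

lemma map_germ_compose:
  assumes "map_germ a" "map_germ b"
  shows "map_germ (\<lambda>z. b (a z))"
  using assms holomorphic_map_compose(1) by (auto simp: map_germ_def)

lemma map_germ_isCont: "map_germ f \<Longrightarrow> isCont f 0"
  using holomorphic_map_isCont by (auto simp: map_germ_def)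

lemma differential_compose:
  assumes "map_germ a" "map_germ b"
  shows "\<forall>\<^sub>F z in nhds 0. differential (\<lambda>z. b (a z)) z = (\<lambda>h. differential b (a z) (differential a z h))"
  using assms holomorphic_map_compose(2) by (auto simp: map_germ_def)

lemma differential_inverse:
  assumes "inverse_biholomorphisms \<phi> \<phi>'"
  shows "\<forall>\<^sub>F z in nhds 0. \<forall>h. differential \<phi>' (\<phi> z) (differential \<phi> z h) = h"
proof -
  have \<phi>: "map_germ \<phi>" "map_germ \<phi>'" and inv: "\<forall>\<^sub>F z in nhds 0. \<phi>' (\<phi> z) = z"
    using assms by (auto simp: inverse_biholomorphisms_def)
  have "holomorphic_map_at_0 (\<lambda>z. \<phi>' (\<phi> z))"
    using map_germ_compose[OF \<phi>] by (simp add: map_germ_def)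
  from differential_cong[OF inv this] differential_compose[OF \<phi>]
  show ?thesis
    by eventually_elim (metis frechet_derivative_ident)
qed

text \<open>Vector fields along f are carried to fields along f' by composing with
  \<open>\<rho>'\<close> and applying the differential of \<open>\<psi>\<close>. Surjectivity on
  \<open>theta\<close> and preservation of the tangent spaces already give this inequality; the
  reverse one comes from exchanging f and f'.\<close>

lemma Ae_cod_le_of_equivalent:
  assumes f: "map_germ f" and f': "map_germ f'"
    and \<rho>: "inverse_biholomorphisms \<rho> \<rho>'" and \<psi>: "inverse_biholomorphisms \<psi> \<psi>'"
    and eq: "\<forall>\<^sub>F z in nhds 0. f' z = \<psi> (f (\<rho>' z))"
  shows "Ae_cod f' \<le> Ae_cod f"
proof -
  note germs = \<rho>[unfolded inverse_biholomorphisms_def] \<psi>[unfolded inverse_biholomorphisms_def]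
  have maps: "map_germ \<rho>" "map_germ \<rho>'" "map_germ \<psi>" "map_germ \<psi>'" using germs by blast+
  have hol: "holomorphic_map_at_0 \<rho>" "holomorphic_map_at_0 \<rho>'" "holomorphic_map_at_0 \<psi>"
    "holomorphic_map_at_0 \<psi>'" "holomorphic_map_at_0 f"
    and zero: "\<rho> 0 = 0" "\<rho>' 0 = 0" "\<psi> 0 = 0" "\<psi>' 0 = 0" "f 0 = 0"
    using maps f by (auto simp: map_germ_def)
  have \<rho>': "isCont \<rho>' 0" "\<rho>' 0 = 0" using map_germ_isCont maps zero by auto
  have f\<rho>': "map_germ (\<lambda>z. f (\<rho>' z))" using map_germ_compose maps(2) f .
  define \<Phi> where "\<Phi> = germ_transport (\<lambda>z. differential \<psi> (f (\<rho>' z))) \<rho>'"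
  have \<Phi>_of: "\<Phi> (germ_of v) = germ_of (\<lambda>z. differential \<psi> (f (\<rho>' z)) (v (\<rho>' z)))" for v
    unfolding \<Phi>_def by (rule germ_transport_of[OF \<rho>'])
  have lin_\<psi>: "\<forall>\<^sub>F z in nhds 0. linear (differential \<psi> (f (\<rho>' z))) \<and>
      (\<forall>c h. differential \<psi> (f (\<rho>' z)) (c *s h) = c *s differential \<psi> (f (\<rho>' z)) h)"
    by (rule eventually_compose_map_germ[OF f\<rho>' eventually_linear_differential[OF hol(3)]])
  have lin: "linear_between (germ_scale (*s)) (germ_scale (*s)) theta \<Phi>"
    unfolding \<Phi>_def
    by (rule linear_germ_transport[OF \<rho>'], rule eventually_mono[OF lin_\<psi>]) (auto simp: linear_add)
  have "\<Phi> ` theta = theta"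
  proof (intro equalityI subsetI)
    fix y :: "(complex^'a, complex^'b) germ" assume "y \<in> \<Phi> ` theta"
    then obtain v where v: "y = \<Phi> (germ_of v)" "holomorphic_map_at_0 v"
      by (auto elim: thetaE)
    then show "y \<in> theta"
      using holomorphic_map_differential[OF hol(3), of "\<lambda>z. f (\<rho>' z)" "\<lambda>z. v (\<rho>' z)"] f\<rho>'
        holomorphic_map_compose(1)[OF hol(2) zero(2) v(2)]
      by (simp add: \<Phi>_of germ_of_in_theta map_germ_def)
  next
    fix y :: "(complex^'a, complex^'b) germ" assume "y \<in> theta"
    then obtain w where w: "y = germ_of w" "holomorphic_map_at_0 w" by (rule thetaE)
    \<comment> \<open>The inverse transport: compose with \<open>\<rho>\<close> and apply the
      differential of \<open>\<psi>'\<close> along \<open>\<psi> (f z)\<close>.\<close>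
    define v where "v = (\<lambda>z. differential \<psi>' (\<psi> (f z)) (w (\<rho> z)))"
    have "holomorphic_map_at_0 v"
      unfolding v_def
      using holomorphic_map_differential[OF hol(4), of "\<lambda>z. \<psi> (f z)" "\<lambda>z. w (\<rho> z)"]
        map_germ_compose[OF f maps(3)] holomorphic_map_compose(1)[OF hol(1) zero(1) w(2)]
      by (simp add: map_germ_def)
    moreover have "\<Phi> (germ_of v) = y"
      unfolding \<Phi>_of w(1) germ_of_eq_iff
    proof -
      have "\<forall>\<^sub>F z in nhds 0. \<psi>' (\<psi> (f (\<rho>' z))) = f (\<rho>' z)"
        using eventually_compose_map_germ[OF f\<rho>', where P = "\<lambda>q. \<psi>' (\<psi> q) = q"] germs by blast
      moreover have "\<forall>\<^sub>F z in nhds 0. \<forall>h. differential \<psi> (\<psi>' (\<psi> (f (\<rho>' z))))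
          (differential \<psi>' (\<psi> (f (\<rho>' z))) h) = h"
        using eventually_compose_map_germ[OF map_germ_compose[OF f\<rho>' maps(3)]
            differential_inverse[OF inverse_biholomorphisms_sym[OF \<psi>]]] .
      moreover have "\<forall>\<^sub>F z in nhds 0. \<rho> (\<rho>' z) = z" using germs by blast
      ultimately show "\<forall>\<^sub>F z in nhds 0. differential \<psi> (f (\<rho>' z)) (v (\<rho>' z)) = w z"
        by eventually_elim (simp add: v_def)
    qed
    ultimately show "y \<in> \<Phi> ` theta" by (metis germ_of_in_theta imageI)
  qed
  moreover have "\<Phi> x \<in> TAe f'" if x_TAe: "x \<in> TAe f" for x
  proof -
    obtain \<epsilon> \<eta> where \<epsilon>\<eta>: "holomorphic_map_at_0 \<epsilon>" "holomorphic_map_at_0 \<eta>"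
      and x: "x = germ_of (\<lambda>z. differential f z (\<epsilon> z) + \<eta> (f z))"
      using x_TAe by (rule TAe_E)
    \<comment> \<open>The fields for f' are the push-forwards of \<open>\<epsilon>\<close> by
      \<open>\<rho>\<close> and of \<open>\<eta>\<close> by \<open>\<psi>\<close>. In
      \<open>differential f' z\<close> applied to the first, the differentials of
      \<open>\<rho>'\<close> and \<open>\<rho>\<close> cancel.\<close>
    let ?\<epsilon> = "\<lambda>z. differential \<rho> (\<rho>' z) (\<epsilon> (\<rho>' z))"
    let ?\<eta> = "\<lambda>y. differential \<psi> (\<psi>' y) (\<eta> (\<psi>' y))"
    show ?thesis
      unfolding x \<Phi>_of
    proof (rule TAe_I[of ?\<epsilon> ?\<eta>])
      show "holomorphic_map_at_0 ?\<epsilon>"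
        by (rule holomorphic_map_differential[OF hol(1) hol(2) zero(2)
              holomorphic_map_compose(1)[OF hol(2) zero(2) \<epsilon>\<eta>(1)]])
      show "holomorphic_map_at_0 ?\<eta>"
        by (rule holomorphic_map_differential[OF hol(3) hol(4) zero(4)
              holomorphic_map_compose(1)[OF hol(4) zero(4) \<epsilon>\<eta>(2)]])
      have "\<forall>\<^sub>F z in nhds 0. differential f' z = differential (\<lambda>z. \<psi> (f (\<rho>' z))) z"
        using differential_cong[OF eq] f' by (simp add: map_germ_def)
      moreover have "\<forall>\<^sub>F z in nhds 0. differential (\<lambda>z. \<psi> (f (\<rho>' z))) z
          = (\<lambda>h. differential \<psi> (f (\<rho>' z)) (differential (\<lambda>z. f (\<rho>' z)) z h))"
        by (rule differential_compose[OF f\<rho>' maps(3)])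
      moreover have "\<forall>\<^sub>F z in nhds 0. differential (\<lambda>z. f (\<rho>' z)) z
          = (\<lambda>h. differential f (\<rho>' z) (differential \<rho>' z h))"
        by (rule differential_compose[OF maps(2) f])
      moreover have "\<forall>\<^sub>F z in nhds 0. \<forall>h. differential \<rho>' (\<rho> (\<rho>' z)) (differential \<rho> (\<rho>' z) h) = h"
        by (rule eventually_compose_map_germ[OF maps(2) differential_inverse[OF \<rho>]])
      moreover have "\<forall>\<^sub>F z in nhds 0. \<rho> (\<rho>' z) = z" using germs by blast
      moreover have "\<forall>\<^sub>F z in nhds 0. \<psi>' (\<psi> (f (\<rho>' z))) = f (\<rho>' z)"
        using eventually_compose_map_germ[OF f\<rho>', where P = "\<lambda>q. \<psi>' (\<psi> q) = q"] germs by blast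
      ultimately show "\<forall>\<^sub>F z in nhds 0.
          differential \<psi> (f (\<rho>' z)) (differential f (\<rho>' z) (\<epsilon> (\<rho>' z)) + \<eta> (f (\<rho>' z)))
          = differential f' z (?\<epsilon> z) + ?\<eta> (f' z)"
        using eq lin_\<psi> by eventually_elim (simp add: linear_add)
    qed
  qed
  ultimately show ?thesis
    using qdim_image_le[OF vector_space_map_germs vector_space_map_germs subspace_theta
        subspace_TAe[OF f] lin, of "TAe f'"]
    by (simp add: Ae_cod_eq_qdim f f')
qed

text \<open>Composition with \<open>\<rho>'\<close> maps function germs onto function germs and
  sends u o f to (u o \<open>\<psi>'\<close>) o f', so pulled-back germs go to pulled-back
  germs.\<close>

lemma delta_le_of_equivalent:
  assumes f: "map_germ f" and f': "map_germ f'"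
    and \<rho>: "inverse_biholomorphisms \<rho> \<rho>'" and \<psi>: "inverse_biholomorphisms \<psi> \<psi>'"
    and eq: "\<forall>\<^sub>F z in nhds 0. f' z = \<psi> (f (\<rho>' z))"
  shows "delta f' \<le> delta f"
proof -
  note germs = \<rho>[unfolded inverse_biholomorphisms_def] \<psi>[unfolded inverse_biholomorphisms_def]
  have hol: "holomorphic_map_at_0 \<rho>" "holomorphic_map_at_0 \<rho>'" "holomorphic_map_at_0 \<psi>'"
    and zero: "\<rho> 0 = 0" "\<rho>' 0 = 0" "\<psi>' 0 = 0"
    using germs by (auto simp: map_germ_def)
  have \<rho>': "isCont \<rho>' 0" "\<rho>' 0 = 0" using holomorphic_map_isCont hol zero by auto
  have f\<rho>': "map_germ (\<lambda>z. f (\<rho>' z))" using map_germ_compose germs f by blast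
  define \<Phi> :: "(complex^'a, complex) germ \<Rightarrow> _"
    where "\<Phi> = germ_transport (\<lambda>z x. x) \<rho>'"
  have \<Phi>_of: "\<Phi> (germ_of v) = germ_of (\<lambda>z. v (\<rho>' z))" for v
    unfolding \<Phi>_def by (rule germ_transport_of[OF \<rho>'])
  have lin: "linear_between (germ_scale (*)) (germ_scale (*)) function_germs \<Phi>"
    unfolding \<Phi>_def by (rule linear_germ_transport[OF \<rho>']) simp
  have "\<Phi> ` function_germs = function_germs"
  proof (intro equalityI subsetI)
    fix y assume "y \<in> \<Phi> ` function_germs"
    then show "y \<in> function_germs"
      using holomorphic_at_0_compose[OF hol(2) zero(2)]
      by (auto elim!: function_germsE simp: \<Phi>_of germ_of_in_function_germs)
  next
    fix y :: "(complex^'a, complex) germ" assume "y \<in> function_germs"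
    then obtain w where w: "y = germ_of w" "holomorphic_at_0 w" by (rule function_germsE)
    have "\<forall>\<^sub>F z in nhds 0. \<rho> (\<rho>' z) = z" using germs by blast
    then have "\<Phi> (germ_of (\<lambda>z. w (\<rho> z))) = y"
      unfolding \<Phi>_of w(1) germ_of_eq_iff by eventually_elim simp
    moreover have "germ_of (\<lambda>z. w (\<rho> z)) \<in> function_germs"
      using holomorphic_at_0_compose[OF hol(1) zero(1) w(2)] by (simp add: germ_of_in_function_germs)
    ultimately show "y \<in> \<Phi> ` function_germs" by blast
  qed
  moreover have "\<Phi> x \<in> pullback_germs f'" if x: "x \<in> pullback_germs f" for x
  proof -
    obtain u where u: "holomorphic_at_0 u" "x = germ_of (\<lambda>z. u (f z))"
      using x by (rule pullback_germs_E)
    have "\<forall>\<^sub>F z in nhds 0. \<psi>' (\<psi> (f (\<rho>' z))) = f (\<rho>' z)"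
      using eventually_compose_map_germ[OF f\<rho>', where P = "\<lambda>q. \<psi>' (\<psi> q) = q"] germs by blast
    with eq have "\<forall>\<^sub>F z in nhds 0. u (f (\<rho>' z)) = u (\<psi>' (f' z))"
      by eventually_elim simp
    then show ?thesis
      unfolding u \<Phi>_of
      by (rule pullback_germs_I[OF holomorphic_at_0_compose[OF hol(3) zero(3) u(1)]])
  qed
  ultimately show ?thesis
    using qdim_image_le[OF vector_space_function_germs vector_space_function_germs
        subspace_function_germs subspace_pullback_germs[of f] lin, of "pullback_germs f'"]
    by (simp add: delta_eq_qdim f f')
qed

lemma A_equivalent_invariants:
  assumes f: "map_germ f" and f': "map_germ f'" and "A_equivalent f f'"
  shows "Ae_cod f' = Ae_cod f" and "delta f' = delta f"
proof -
  obtain \<rho> \<rho>' \<psi> \<psi>' where \<rho>: "inverse_biholomorphisms \<rho> \<rho>'" and \<psi>: "inverse_biholomorphisms \<psi> \<psi>'"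
    and eq: "\<forall>\<^sub>F z in nhds 0. f' z = \<psi> (f (\<rho>' z))"
    using assms(3) unfolding A_equivalent_def by blast
  note germs = \<rho>[unfolded inverse_biholomorphisms_def] \<psi>[unfolded inverse_biholomorphisms_def]
  \<comment> \<open>The relation is solved for f near 0, which presents f as equivalent to f'
    through the inverse germs and yields the opposite inequalities.\<close>
  have "\<forall>\<^sub>F z in nhds 0. f' (\<rho> z) = \<psi> (f (\<rho>' (\<rho> z)))"
    using eventually_compose_map_germ[OF _ eq] germs by blast
  moreover have "\<forall>\<^sub>F z in nhds 0. \<psi>' (\<psi> (f z)) = f z"
    using eventually_compose_map_germ[OF f, where P = "\<lambda>q. \<psi>' (\<psi> q) = q"] germs by blast
  moreover have "\<forall>\<^sub>F z in nhds 0. \<rho>' (\<rho> z) = z" using germs by blast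
  ultimately have eq': "\<forall>\<^sub>F z in nhds 0. f z = \<psi>' (f' (\<rho> z))"
    by eventually_elim simp
  note sym = inverse_biholomorphisms_sym[OF \<rho>] inverse_biholomorphisms_sym[OF \<psi>]
  show "Ae_cod f' = Ae_cod f"
    using Ae_cod_le_of_equivalent[OF f f' \<rho> \<psi> eq] Ae_cod_le_of_equivalent[OF f' f sym eq'] by simp
  show "delta f' = delta f"
    using delta_le_of_equivalent[OF f f' \<rho> \<psi> eq] delta_le_of_equivalent[OF f' f sym eq'] by simp
qed


section \<open>Germs of the form \<open>(g, h)\<close>\<close>

definition first_block :: "complex^('k::finite + 'm::finite) \<Rightarrow> complex^'k" where
  "first_block v = (\<chi> a. v $ Inl a)"

lemma block_nth [simp]:
  "first_block v $ a = v $ Inl a" "second_block v $ b = v $ Inr b"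
  "join x y $ Inl a = x $ a" "join x y $ Inr b = y $ b"
  by (simp_all add: first_block_def second_block_def join_def)

lemma vec_sum_eq_iff:
  fixes v w :: "complex^('k::finite + 'm::finite)"
  shows "v = w \<longleftrightarrow> first_block v = first_block w \<and> second_block v = second_block w"
  unfolding vec_eq_iff by (metis block_nth(1,2) sum.exhaust)

lemma join_blocks [simp]:
  "first_block (join x y) = x" "second_block (join x y) = y"
  "join (first_block v) (second_block v) = v"
  by (simp_all add: vec_sum_eq_iff) (simp_all add: vec_eq_iff)

lemma block_linear:
  "first_block (v + w) = first_block v + first_block w"
  "second_block (v + w) = second_block v + second_block w"
  "first_block (c *s v) = c *s first_block v"
  "second_block (c *s v) = c *s second_block v"
  by (simp_all add: vec_eq_iff)

lemma join_0_linear: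
  "join 0 (x + y) = join 0 x + join 0 y"
  "join 0 (c *s x) = c *s join 0 x"
  by (simp_all add: vec_sum_eq_iff) (simp_all add: vec_eq_iff)

lemma holomorphic_first_block: "holomorphic_map_at_0 v \<Longrightarrow> holomorphic_map_at_0 (\<lambda>z. first_block (v z))"
  by (simp add: holomorphic_map_at_0_def)

lemma holomorphic_second_block: "holomorphic_map_at_0 v \<Longrightarrow> holomorphic_map_at_0 (\<lambda>z. second_block (v z))"
  by (simp add: holomorphic_map_at_0_def)

lemma holomorphic_join:
  assumes "holomorphic_map_at_0 v" "holomorphic_map_at_0 w"
  shows "holomorphic_map_at_0 (\<lambda>z. join (v z) (w z))"
  unfolding holomorphic_map_at_0_def
proof
  fix j :: "'b + 'c"
  show "holomorphic_at_0 (\<lambda>z. join (v z) (w z) $ j)"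
    using assms by (cases j) (simp_all add: holomorphic_map_at_0_def)
qed

lemma map_germ_pair_map:
  assumes "map_germ g" "map_germ h"
  shows "map_germ (pair_map g h)"
  using assms holomorphic_join[of g h]
  by (auto simp: map_germ_def pair_map_def[abs_def] vec_sum_eq_iff) (simp_all add: vec_eq_iff)

text \<open>Taking the first block is linear and so commutes with differentiation; for f = (g, h)
  this identifies dg with the first block of df.\<close>

lemma first_block_differential:
  assumes "holomorphic_map_at_0 f"
  shows "\<forall>\<^sub>F z in nhds 0. differential (\<lambda>z. first_block (f z)) z = (\<lambda>e. first_block (differential f z e))"
  using eventually_has_derivative[OF assms]
proof eventually_elim
  case (elim z)
  have "bounded_linear (first_block :: complex^('b + 'c) \<Rightarrow> _)"
    by (auto intro!: linear_conv_bounded_linear[THEN iffD1] linearI simp: vec_eq_iff)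
  from bounded_linear.has_derivative[OF this, of f "differential f z" "at z"] elim
  show ?case by (simp add: frechet_derivative_at[symmetric])
qed

text \<open>The condition that a component lie in P is lifted one index at a time, and each index
  contributes one copy of the codimension of P. Additivity in \<open>enat\<close> keeps this valid
  when that codimension is infinite.\<close>

lemma theta_qdim_componentwise:
  fixes P :: "(complex^'n, complex) germ set"
  assumes P: "function_germs.subspace P" "P \<subseteq> function_germs"
  defines "W \<equiv> {x \<in> (theta :: (complex^'n, complex^'m) germ set).
    \<forall>b. germ_transport (\<lambda>_ v. v $ b) (\<lambda>z. z) x \<in> P}"
  shows "map_germs.subspace W"
    and "qdim (germ_scale (*s)) theta W = enat CARD('m) * qdim (germ_scale (*)) function_germs P"
proof -
  define c :: "'m \<Rightarrow> (complex^'n, complex^'m) germ \<Rightarrow> (complex^'n, complex) germ"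
    where "c = (\<lambda>b. germ_transport (\<lambda>_ v. v $ b) (\<lambda>z. z))"
  have id: "isCont (\<lambda>z. z) (0 :: complex^'n)" "(\<lambda>z. z) (0 :: complex^'n) = 0" by auto
  have c_of: "c b (germ_of v) = germ_of (\<lambda>z. v z $ b)" for b v
    unfolding c_def by (rule germ_transport_of[OF id])
  have lin: "linear_between (germ_scale (*s)) (germ_scale (*)) V (c b)" for V b
    unfolding c_def by (rule linear_germ_transport[OF id]) simp
  have c_lin: "c b (x + y) = c b x + c b y" "c b (germ_scale (*s) r x) = germ_scale (*) r (c b x)" for b x y r
    using lin[of UNIV b] by (simp_all add: linear_between_def)
  have c_0: "c b 0 = 0" for b
    by (simp add: zero_germ_def c_of)
  \<comment> \<open>Only components outside B are constrained: B empty gives W, and B the full index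
    set gives \<open>theta\<close>. Component b maps \<open>V (insert b B)\<close> onto the function
    germs, and \<open>V B\<close> is the preimage of P.\<close>
  define V where "V = (\<lambda>B. {x \<in> theta. \<forall>b. b \<notin> B \<longrightarrow> c b x \<in> P})"
  have V_sub: "map_germs.subspace (V B)" for B
    unfolding V_def map_germs.subspace_def
    by (simp add: c_0 c_lin function_germs.subspace_0[OF P(1)] function_germs.subspace_add[OF P(1)]
        function_germs.subspace_scale[OF P(1)] map_germs.subspace_0[OF subspace_theta]
        map_germs.subspace_add[OF subspace_theta] map_germs.subspace_scale[OF subspace_theta])
  have W: "W = V {}" by (simp add: W_def V_def c_def)
  show "map_germs.subspace W" unfolding W by (rule V_sub)
  have "qdim (germ_scale (*s)) (V B) (V {}) = enat (card B) * qdim (germ_scale (*)) function_germs P"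
    if "finite B" for B
    using that
  proof (induction B)
    case empty
    show ?case using qdim_self[OF vector_space_map_germs V_sub] by (simp flip: zero_enat_def)
  next
    case (insert b B)
    have "c b ` V (insert b B) = function_germs"
    proof (intro equalityI subsetI)
      fix y assume "y \<in> c b ` V (insert b B)"
      then obtain v where "y = c b (germ_of v)" "holomorphic_map_at_0 v"
        by (auto simp: V_def elim!: thetaE)
      then show "y \<in> function_germs"
        by (simp add: c_of germ_of_in_function_germs holomorphic_map_at_0_def)
    next
      fix y :: "(complex^'n, complex) germ" assume "y \<in> function_germs"
      then obtain u where u: "y = germ_of u" "holomorphic_at_0 u" by (rule function_germsE)
      \<comment> \<open>A field with u in position b and 0 elsewhere lies in
        \<open>V (insert b B)\<close>, because 0 belongs to P.\<close>
      let ?x = "germ_of (\<lambda>z. axis b (u z)) :: (complex^'n, complex^'m) germ"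
      have cx: "c b' ?x = (if b' = b then y else 0)" for b'
        by (simp add: c_of u zero_germ_def axis_def)
      have "holomorphic_map_at_0 (\<lambda>z. axis b (u z))"
        unfolding holomorphic_map_at_0_def
      proof
        fix j show "holomorphic_at_0 (\<lambda>z. axis b (u z) $ j)"
          using u(2) by (cases "j = b") (simp_all add: axis_def holomorphic_at_0_const)
      qed
      then have "?x \<in> V (insert b B)"
        using function_germs.subspace_0[OF P(1)] by (simp add: V_def germ_of_in_theta cx)
      moreover have "y = c b ?x" by (simp add: cx)
      ultimately show "y \<in> c b ` V (insert b B)" by blast
    qed
    moreover have "c b x \<in> P \<longleftrightarrow> x \<in> V B" if "x \<in> V (insert b B)" for x
      using that insert.hyps by (auto simp: V_def)
    ultimately have "qdim (germ_scale (*s)) (V (insert b B)) (V B) = qdim (germ_scale (*)) function_germs P"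
      using qdim_image_eq[OF vector_space_map_germs vector_space_function_germs V_sub V_sub P(1) lin, of "insert b B" b B]
      by simp
    moreover have "qdim (germ_scale (*s)) (V (insert b B)) (V {})
        = qdim (germ_scale (*s)) (V (insert b B)) (V B) + qdim (germ_scale (*s)) (V B) (V {})"
      by (rule qdim_additive[OF vector_space_map_germs V_sub V_sub V_sub]) (auto simp: V_def)
    moreover have "enat (Suc (card B)) = 1 + enat (card B)"
      by (simp add: one_enat_def)
    ultimately show ?case
      using insert by (simp add: distrib_right)
  qed
  from this[of UNIV]
  show "qdim (germ_scale (*s)) theta W = enat CARD('m) * qdim (germ_scale (*)) function_germs P"
    by (simp add: W) (simp add: V_def)
qed

section \<open>Tangent space, T and the kernel of rho for a fixed pair (g, h)\<close>

context
  fixes g :: "complex^'n \<Rightarrow> complex^'k::finite" and h :: "complex^'n \<Rightarrow> complex^'m::finite"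
  assumes g: "map_germ g" and h: "map_germ h"
begin

private definition F where "F = pair_map g h"

private definition inclusion ::
    "(complex^'n, complex^'m) germ \<Rightarrow> (complex^'n, complex^('k + 'm)) germ" where
  "inclusion = germ_transport (\<lambda>_. join 0) (\<lambda>z. z)"

private definition projection ::
    "(complex^'n, complex^('k + 'm)) germ \<Rightarrow> (complex^'n, complex^'k) germ" where
  "projection = germ_transport (\<lambda>_. first_block) (\<lambda>z. z)"

private lemma F: "map_germ F" "\<And>z. first_block (F z) = g z"
  using map_germ_pair_map[OF g h] by (simp_all add: F_def pair_map_def)

private lemma isCont_ident_0: "isCont (\<lambda>z. z) (0 :: complex^'n)" "(\<lambda>z. z) (0 :: complex^'n) = 0"
  by auto

private lemma inclusion_of: "inclusion (germ_of v) = germ_of (\<lambda>z. join 0 (v z))"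
  unfolding inclusion_def by (rule germ_transport_of[OF isCont_ident_0])

private lemma projection_of: "projection (germ_of v) = germ_of (\<lambda>z. first_block (v z))"
  unfolding projection_def by (rule germ_transport_of[OF isCont_ident_0])

private lemma inclusion_linear: "linear_between (germ_scale (*s)) (germ_scale (*s)) V inclusion"
  unfolding inclusion_def by (rule linear_germ_transport[OF isCont_ident_0]) (simp add: join_0_linear)

private lemma projection_linear: "linear_between (germ_scale (*s)) (germ_scale (*s)) V projection"
  unfolding projection_def by (rule linear_germ_transport[OF isCont_ident_0]) (simp add: block_linear)

private lemma T_space_iff: "x \<in> T_space g h \<longleftrightarrow> x \<in> theta \<and> inclusion x \<in> TAe F"
  unfolding T_space_def F_def[symmetric]
  by (auto simp: germ_of_in_theta inclusion_of elim!: thetaE)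

private lemma subspace_vimage:
  assumes "map_germs.subspace V" "map_germs.subspace W"
    and "linear_between (germ_scale (*s)) (germ_scale (*s)) V \<phi>"
  shows "map_germs.subspace {x \<in> V. \<phi> x \<in> W}"
proof -
  have "\<phi> (germ_scale (*s) 0 0) = germ_scale (*s) 0 (\<phi> 0)"
    using assms(3) map_germs.subspace_0[OF assms(1)] unfolding linear_between_def by blast
  then have "\<phi> 0 = 0" by simp
  then show ?thesis
    using assms by (simp add: map_germs.subspace_def linear_between_def)
qed

private lemma subspace_T_space: "map_germs.subspace (T_space g h)"
proof -
  have "T_space g h = {x \<in> theta. inclusion x \<in> TAe F}" using T_space_iff by blast
  then show ?thesis
    using subspace_vimage[OF subspace_theta subspace_TAe[OF F(1)] inclusion_linear] by simp
qed

private lemma T_space_subset: "T_space g h \<subseteq> theta"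
  using T_space_iff by blast

private lemma subspace_projection_TAe: "map_germs.subspace (projection ` TAe F)"
proof -
  note TAe = subspace_TAe[OF F(1)]
  have add: "projection (x + y) = projection x + projection y"
    and scale: "projection (germ_scale (*s) c x) = germ_scale (*s) c (projection x)" for x y c
    using projection_linear[of UNIV] by (simp_all add: linear_between_def)
  show ?thesis
    unfolding map_germs.subspace_def
  proof (intro conjI ballI allI)
    have "projection (germ_scale (*s) 0 0) = 0" unfolding scale by simp
    then have "projection 0 = 0" by simp
    then show "0 \<in> projection ` TAe F"
      using map_germs.subspace_0[OF TAe] by (metis imageI)
  qed (use add scale map_germs.subspace_add[OF TAe] map_germs.subspace_scale[OF TAe] in
      \<open>force simp flip: add scale\<close>)+
qed

text \<open>The source field lifts unchanged and the target field \<open>\<eta>\<close> lifts to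
  (\<open>\<eta>\<close>, 0), constant along the second block. Equality is not to be expected:
  target fields of the pair may depend on the values of h.\<close>

private lemma TAe_g_subset: "TAe g \<subseteq> projection ` TAe F"
proof
  fix x assume "x \<in> TAe g"
  then obtain \<epsilon> \<eta> where hol: "holomorphic_map_at_0 \<epsilon>" "holomorphic_map_at_0 \<eta>"
    and x: "x = germ_of (\<lambda>z. differential g z (\<epsilon> z) + \<eta> (g z))"
    by (rule TAe_E)
  let ?\<eta> = "\<lambda>y :: complex^('k + 'm). join (\<eta> (first_block y)) 0 :: complex^('k + 'm)"
  have "holomorphic_map_at_0 (\<lambda>y :: complex^('k + 'm). y)"
    by (simp add: holomorphic_map_at_0_def holomorphic_at_0_nth)
  from holomorphic_first_block[OF this]
  have "holomorphic_map_at_0 (\<lambda>y :: complex^('k + 'm). \<eta> (first_block y))"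
    by (rule holomorphic_map_compose(1)[OF _ _ hol(2)]) (simp add: vec_eq_iff)
  then have \<eta>: "holomorphic_map_at_0 ?\<eta>"
    by (rule holomorphic_join[OF _ holomorphic_map_zero])
  have "x = projection (germ_of (\<lambda>z. differential F z (\<epsilon> z) + ?\<eta> (F z)))"
    unfolding x projection_of germ_of_eq_iff
    using first_block_differential[of F] F by (auto simp: map_germ_def block_linear elim: eventually_mono)
  moreover have "germ_of (\<lambda>z. differential F z (\<epsilon> z) + ?\<eta> (F z)) \<in> TAe F"
    by (rule TAe_I[OF hol(1) \<eta>]) simp
  ultimately show "x \<in> projection ` TAe F" by blast
qed

text \<open>The short exact sequence \<open>0 \<rightarrow> \<theta>(h) \<rightarrow> \<theta>(g, h) \<rightarrow> \<theta>(g) \<rightarrow> 0\<close>, modulo the tangent space of \<open>(g, h)\<close>.\<close>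

private lemma Ae_cod_pair_map_exact:
  "Ae_cod F = qdim (germ_scale (*s)) theta (projection ` TAe F) + cod_T g h"
proof -
  \<comment> \<open>K is the sum of \<open>TAe F\<close> and the fields with zero first block.
    Cutting at K separates the contribution of the projected tangent space from that of T.\<close>
  define K where "K = {x \<in> theta. projection x \<in> projection ` TAe F}"
  note vs = vector_space_map_germs
  note TAe = subspace_TAe[OF F(1)] TAe_subset_theta[OF F(1)]
  have K: "map_germs.subspace K"
    unfolding K_def by (rule subspace_vimage[OF subspace_theta subspace_projection_TAe projection_linear])
  have TAe_K: "TAe F \<subseteq> K" using TAe(2) by (auto simp: K_def)
  have "projection ` theta = theta"
  proof (intro equalityI subsetI)
    fix y assume "y \<in> projection ` theta"
    then show "y \<in> theta"
      by (auto elim!: thetaE simp: projection_of germ_of_in_theta holomorphic_first_block)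
  next
    fix y :: "(complex^'n, complex^'k) germ" assume "y \<in> theta"
    then obtain v where v: "y = germ_of v" "holomorphic_map_at_0 v" by (rule thetaE)
    have "y = projection (germ_of (\<lambda>z. join (v z) 0))" by (simp add: v projection_of)
    moreover have "germ_of (\<lambda>z. join (v z) 0) \<in> theta"
      using v by (simp add: germ_of_in_theta holomorphic_join holomorphic_map_zero)
    ultimately show "y \<in> projection ` theta" by blast
  qed
  then have "qdim (germ_scale (*s)) theta K = qdim (germ_scale (*s)) theta (projection ` TAe F)"
    using qdim_image_eq[OF vs vs subspace_theta K subspace_projection_TAe projection_linear]
    by (simp add: K_def)
  moreover have "qdim (germ_scale (*s)) K (TAe F) = qdim (germ_scale (*s)) (inclusion ` theta) (TAe F)"
  proof (rule qdim_sum_eq[OF vs TAe(1)])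
    show "inclusion ` theta \<subseteq> K"
    proof
      fix x assume "x \<in> inclusion ` theta"
      then obtain v where v: "x = inclusion (germ_of v)" "holomorphic_map_at_0 v"
        by (auto elim: thetaE)
      have "projection x = 0"
        by (simp add: v inclusion_of projection_of zero_germ_def)
      moreover have "x \<in> theta"
        using v by (simp add: inclusion_of germ_of_in_theta holomorphic_join holomorphic_map_zero)
      ultimately show "x \<in> K"
        using map_germs.subspace_0[OF subspace_projection_TAe] by (simp add: K_def)
    qed
  next
    fix x assume "x \<in> K"
    then obtain y where x: "x \<in> theta" and y: "y \<in> TAe F" "projection x = projection y"
      by (auto simp: K_def)
    obtain v where v: "x = germ_of v" "holomorphic_map_at_0 v" using x by (rule thetaE)
    obtain w where w: "y = germ_of w" "holomorphic_map_at_0 w" using y(1) TAe(2) by (auto elim: thetaE)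
    have "x - y \<in> theta" by (rule map_germs.subspace_diff[OF subspace_theta x]) (use y TAe in blast)
    then have vw: "holomorphic_map_at_0 (\<lambda>z. v z - w z)"
      by (simp add: v w minus_germ.abs_eq germ_of_in_theta)
    \<comment> \<open>After subtraction of an element of \<open>TAe F\<close> with the same
      projection, only a second block is left.\<close>
    let ?u = "germ_of (\<lambda>z. second_block (v z - w z))"
    have "\<forall>\<^sub>F z in nhds 0. first_block (v z) = first_block (w z)"
      using y(2) by (simp add: v w projection_of germ_of_eq_iff)
    then have "\<forall>\<^sub>F z in nhds 0. v z - join 0 (second_block (v z - w z)) = w z"
      by eventually_elim (simp add: vec_sum_eq_iff vec_eq_iff)
    then have "x - inclusion ?u = y"
      by (simp add: v w inclusion_of minus_germ.abs_eq germ_of_eq_iff)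
    moreover have "?u \<in> theta"
      using holomorphic_second_block[OF vw] by (simp add: germ_of_in_theta)
    ultimately show "\<exists>u\<in>inclusion ` theta. x - u \<in> TAe F" using y(1) by blast
  qed
  moreover have "qdim (germ_scale (*s)) (inclusion ` theta) (TAe F)
      = qdim (germ_scale (*s)) theta (T_space g h)"
    by (rule qdim_image_eq[OF vs vs subspace_theta subspace_T_space TAe(1) inclusion_linear])
      (simp add: T_space_iff)
  moreover have "Ae_cod F = qdim (germ_scale (*s)) theta K + qdim (germ_scale (*s)) K (TAe F)"
    unfolding Ae_cod_eq_qdim[OF F(1)]
    by (rule qdim_additive[OF vs TAe(1) K subspace_theta TAe_K]) (auto simp: K_def)
  moreover have "cod_T g h = qdim (germ_scale (*s)) theta (T_space g h)"
    unfolding cod_T_def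
    by (rule quotient_dim_eq_qdim[OF vs subspace_theta subspace_T_space T_space_subset])
  ultimately show ?thesis by simp
qed

text \<open>Membership is a condition on each component separately, because the components of
  \<open>\<eta>\<close> in the second block can be chosen independently and its first block is free.
  This form allows the codimension to be computed componentwise.\<close>

private lemma wh_image_eq:
  "wh_image g h = {x \<in> theta. \<forall>b. germ_transport (\<lambda>_ v. v $ b) (\<lambda>z. z) x \<in> pullback_germs F}"
proof (intro equalityI subsetI)
  fix x assume "x \<in> wh_image g h"
  then obtain \<eta> :: "complex^('k + 'm) \<Rightarrow> complex^('k + 'm)" where \<eta>: "holomorphic_map_at_0 \<eta>"
    and x: "x = germ_of (\<lambda>z. second_block (\<eta> (F z)))"
    by (auto simp: wh_image_def wh_bar_def F_def)
  have "holomorphic_map_at_0 (\<lambda>z. \<eta> (F z))"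
    using F(1) unfolding map_germ_def by (intro holomorphic_map_compose(1)[OF _ _ \<eta>]) auto
  then have "x \<in> theta"
    by (simp add: x germ_of_in_theta holomorphic_second_block)
  moreover have "germ_transport (\<lambda>_ v. v $ b) (\<lambda>z. z) x \<in> pullback_germs F" for b
    unfolding x germ_transport_of[OF isCont_ident_0]
    by (rule pullback_germs_I[of "\<lambda>y. \<eta> y $ Inr b"]) (use \<eta> in \<open>simp_all add: holomorphic_map_at_0_def\<close>)
  ultimately show "x \<in> {x \<in> theta. \<forall>b. germ_transport (\<lambda>_ v. v $ b) (\<lambda>z. z) x \<in> pullback_germs F}"
    by blast
next
  fix x :: "(complex^'n, complex^'m) germ"
  assume x: "x \<in> {x \<in> theta. \<forall>b. germ_transport (\<lambda>_ v. v $ b) (\<lambda>z. z) x \<in> pullback_germs F}"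
  then obtain v where v: "x = germ_of v" "holomorphic_map_at_0 v" by (auto elim: thetaE)
  have "\<exists>u. holomorphic_at_0 u \<and> (\<forall>\<^sub>F z in nhds 0. v z $ b = u (F z))" for b
    using x by (auto simp: v germ_transport_of[OF isCont_ident_0] pullback_germs_def germ_of_eq_iff)
  then obtain u where u: "\<And>b. holomorphic_at_0 (u b)" "\<And>b. \<forall>\<^sub>F z in nhds 0. v z $ b = u b (F z)"
    by metis
  have "holomorphic_map_at_0 (\<lambda>y. \<chi> b. u b y)"
    using u(1) by (simp add: holomorphic_map_at_0_def)
  then have "holomorphic_map_at_0 (\<lambda>y. join 0 (\<chi> b. u b y) :: complex^('k + 'm))"
    by (rule holomorphic_join[OF holomorphic_map_zero])
  \<comment> \<open>There are finitely many components, so their neighbourhoods have a common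
    one.\<close>
  moreover have "\<forall>\<^sub>F z in nhds 0. \<forall>b. v z $ b = u b (F z)"
    using u(2) by (simp add: eventually_all_finite)
  then have "x = wh_bar g h (\<lambda>y. join 0 (\<chi> b. u b y))"
    unfolding v wh_bar_def F_def[symmetric] germ_of_eq_iff
    by eventually_elim (simp add: vec_eq_iff)
  ultimately show "x \<in> wh_image g h"
    unfolding wh_image_def by blast
qed

text \<open>With source field 0 and target field (0, second block of \<open>\<eta>\<close>) the
  tangent vector is exactly (0, \<open>wh_bar g h \<eta>\<close>).\<close>

private lemma wh_image_subset_T_space: "wh_image g h \<subseteq> T_space g h"
proof
  fix x assume x: "x \<in> wh_image g h"
  then obtain \<eta> :: "complex^('k + 'm) \<Rightarrow> complex^('k + 'm)" where \<eta>: "holomorphic_map_at_0 \<eta>"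
    and x_eq: "x = germ_of (\<lambda>z. second_block (\<eta> (F z)))"
    by (auto simp: wh_image_def wh_bar_def F_def)
  have "holomorphic_map_at_0 (\<lambda>y. join 0 (second_block (\<eta> y)) :: complex^('k + 'm))"
    by (rule holomorphic_join[OF holomorphic_map_zero holomorphic_second_block[OF \<eta>]])
  moreover have "\<forall>\<^sub>F z in nhds 0. linear (differential F z)"
    using eventually_linear_differential[of F] F(1) by (auto simp: map_germ_def elim: eventually_mono)
  then have "\<forall>\<^sub>F z in nhds 0. join 0 (second_block (\<eta> (F z)))
      = differential F z 0 + join 0 (second_block (\<eta> (F z)))"
    by eventually_elim (simp add: linear_0)
  ultimately have "inclusion x \<in> TAe F"
    unfolding x_eq inclusion_of by (intro TAe_I[OF holomorphic_map_zero])
  with x show "x \<in> T_space g h"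
    by (simp add: T_space_iff wh_image_eq)
qed

text \<open>Since the image of \<open>wh_bar\<close> lies in T, the union defining the projection
  collapses to a single coset of T, which is the zero coset exactly for representatives in T. Hence
  Ker rho is T modulo that image, and its classes fill T.\<close>

private lemma Union_Ker_rho: "\<Union>(Ker_rho g h) = T_space g h"
proof -
  note T = subspace_T_space
  have wh: "map_germs.subspace (wh_image g h)"
    unfolding wh_image_eq
    by (rule theta_qdim_componentwise(1)[OF subspace_pullback_germs pullback_germs_subset[OF F(1)]])
  have proj: "natural_projection (T_space g h) (coset (wh_image g h) v) = coset (T_space g h) v" for v
  proof -
    have "coset (T_space g h) u = coset (T_space g h) v" if "u \<in> coset (wh_image g h) v" for u
    proof -
      have uv: "u - v \<in> T_space g h"
        using that wh_image_subset_T_space by (auto simp: coset_def)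
      have "w - u \<in> T_space g h \<longleftrightarrow> w - v \<in> T_space g h" for w
        using map_germs.subspace_add[OF T uv, of "w - u"] map_germs.subspace_diff[OF T _ uv, of "w - v"]
        by auto
      then show ?thesis by (simp add: coset_def)
    qed
    moreover have "v \<in> coset (wh_image g h) v"
      using map_germs.subspace_0[OF wh] by (simp add: coset_def)
    ultimately show ?thesis unfolding natural_projection_def by blast
  qed
  have coset_0: "coset (T_space g h) v = coset (T_space g h) 0 \<longleftrightarrow> v \<in> T_space g h" for v
  proof
    assume "coset (T_space g h) v = coset (T_space g h) 0"
    moreover have "v \<in> coset (T_space g h) v"
      using map_germs.subspace_0[OF T] by (simp add: coset_def)
    ultimately show "v \<in> T_space g h" by (simp add: coset_def)
  next
    assume v: "v \<in> T_space g h"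
    then have "w - v \<in> T_space g h \<longleftrightarrow> w \<in> T_space g h" for w
      using map_germs.subspace_add[OF T v, of "w - v"] map_germs.subspace_diff[OF T _ v, of w]
      by auto
    then show "coset (T_space g h) v = coset (T_space g h) 0" by (simp add: coset_def)
  qed
  have "natural_projection (T_space g h) (coset (wh_image g h) v) = coset (T_space g h) 0
      \<longleftrightarrow> v \<in> T_space g h" for v
    by (simp only: proj coset_0)
  then have "Ker_rho g h = quotient_space (T_space g h) (wh_image g h)"
    using T_space_subset unfolding Ker_rho_def quotient_space_def by blast
  then show ?thesis
    using Union_quotient_space[OF vector_space_map_germs T wh wh_image_subset_T_space] by simp
qed

text \<open>Additivity along the chain from the image of \<open>wh_bar\<close> through T to
  \<open>theta\<close>. As a sum it holds with infinite values as well.\<close>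

private lemma cod_T_add_dim_Ker_rho:
  "cod_T g h + dim_Ker_rho g h = enat CARD('m) * delta F"
proof -
  note P = subspace_pullback_germs pullback_germs_subset[OF F(1)]
  note wh = theta_qdim_componentwise[OF P, where 'm = 'm, folded wh_image_eq]
  have "cod_T g h = qdim (germ_scale (*s)) theta (T_space g h)"
    unfolding cod_T_def
    by (rule quotient_dim_eq_qdim[OF vector_space_map_germs subspace_theta subspace_T_space T_space_subset])
  moreover have "dim_Ker_rho g h = qdim (germ_scale (*s)) (T_space g h) (wh_image g h)"
    by (simp add: dim_Ker_rho_def class_dim_eq_qdim Union_Ker_rho)
  moreover have "qdim (germ_scale (*s)) theta (wh_image g h)
      = qdim (germ_scale (*s)) theta (T_space g h) + qdim (germ_scale (*s)) (T_space g h) (wh_image g h)"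
    by (rule qdim_additive[OF vector_space_map_germs wh(1) subspace_T_space subspace_theta
          wh_image_subset_T_space T_space_subset])
  ultimately show ?thesis
    by (simp add: wh(2) delta_eq_qdim[OF F(1)])
qed

lemma Ae_cod_pair_map_le:
  "Ae_cod (pair_map g h) \<le> Ae_cod g + enat CARD('m) * delta (pair_map g h)"
proof -
  have "qdim (germ_scale (*s)) theta (projection ` TAe F) \<le> Ae_cod g"
    unfolding Ae_cod_eq_qdim[OF g] by (rule qdim_antimono[OF TAe_g_subset])
  moreover have "cod_T g h \<le> enat CARD('m) * delta F"
    unfolding cod_T_add_dim_Ker_rho[symmetric] by simp
  ultimately have "Ae_cod F \<le> Ae_cod g + enat CARD('m) * delta F"
    unfolding Ae_cod_pair_map_exact by (rule add_mono)
  then show ?thesis by (simp add: F_def)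
qed

lemma Ae_cod_pair_map_stable:
  assumes "stable_germ g"
  shows "Ae_cod (pair_map g h) = cod_T g h"
proof -
  have "qdim (germ_scale (*s)) (theta :: (complex^'n, complex^'k) germ set) (projection ` TAe F)
      \<le> qdim (germ_scale (*s)) (theta :: (complex^'n, complex^'k) germ set) theta"
    using TAe_g_subset assms by (simp add: stable_germ_def qdim_antimono)
  then have "qdim (germ_scale (*s)) (theta :: (complex^'n, complex^'k) germ set) (projection ` TAe F) = 0"
    by (simp add: qdim_self[OF vector_space_map_germs subspace_theta])
  with Ae_cod_pair_map_exact show ?thesis by (simp add: F_def)
qed

text \<open>The difference is taken in extended reals, where truncated subtraction of natural
  numbers cannot interfere; the finite total makes the cancellation legitimate.\<close>

lemma cod_T_eq_diff:
  assumes "delta (pair_map g h) \<noteq> \<infinity>"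
  shows "ereal_of_enat (cod_T g h) =
    ereal_of_enat (enat CARD('m) * delta (pair_map g h)) - ereal_of_enat (dim_Ker_rho g h)"
proof -
  have sum: "enat CARD('m) * delta (pair_map g h) = cod_T g h + dim_Ker_rho g h"
    using cod_T_add_dim_Ker_rho by (simp add: F_def)
  obtain d where "delta (pair_map g h) = enat d" using assms by auto
  then have "cod_T g h + dim_Ker_rho g h = enat (CARD('m) * d)"
    using sum by simp
  \<comment> \<open>A sum in \<open>enat\<close> is finite only if both summands are.\<close>
  then obtain a b where "cod_T g h = enat a" "dim_Ker_rho g h = enat b"
    by (cases "cod_T g h"; cases "dim_Ker_rho g h") auto
  then show ?thesis unfolding sum by simp
qed

end

theorem theorem5p5:
  fixes f :: "complex^'n \<Rightarrow> complex^('k::finite + 'm::finite)"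
    and g :: "complex^'n \<Rightarrow> complex^'k"
    and h :: "complex^'n \<Rightarrow> complex^'m"
  assumes "CARD('k + 'm) \<ge> 2 * CARD('n)"
    and "map_germ f"
    and "isolated_singularity f"
    and "map_germ g"
    and "map_germ h"
    and "A_equivalent f (pair_map g h)"
    and "A_finitely_determined g"
    and "delta f \<noteq> \<infinity>"
  shows "Ae_cod f \<le> Ae_cod g + enat CARD('m) * delta f \<and>
    (stable_germ g \<longrightarrow>
      Ae_cod f = cod_T g h \<and>
      ereal_of_enat (cod_T g h) =
        ereal_of_enat (enat CARD('m) * delta f) - ereal_of_enat (dim_Ker_rho g h))"
proof -
  note inv = A_equivalent_invariants[OF assms(2) map_germ_pair_map[OF assms(4,5)] assms(6)]
  show ?thesis
    \<comment> \<open>By invariance the codimension and delta of f are replaced by those of (g, h),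
      so finiteness of delta passes to the pair.\<close>
    unfolding inv[symmetric]
    using Ae_cod_pair_map_le Ae_cod_pair_map_stable cod_T_eq_diff assms(4,5,8) inv by metis
qed

end
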